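(* Let $\bar\lambda=\langle\lambda_i: i<\kappa\rangle$ be a sequence of infinite regular cardinals, $I^*$ an ideal on $\kappa$ and $\theta$ a cardinal such that at least one of the following holds: ($\alpha$) $\min_{i<\kappa}\lambda_i>\theta\ge \mathrm{wsat}(I^* )$; or ($\beta$) $\liminf_{I^*}(\bar\lambda)\ge\theta\ge\mathrm{wsat}(I^* )$ and $(\prod\bar\lambda,\le_{I^*})$ is $\theta^+$-directed. If $\lambda=\mathrm{cf}(\lambda)\in\mathrm{pcf}(\bar\lambda)$, then $\lambda$ is semi-normal for $\bar\lambda$.
   Context: $\kappa$ is an infinite cardinal; $I^*$ is a proper ideal on $\kappa$; $\prod\bar\lambda=\prod_{i<\kappa}\lambda_i$. For an ideal $J$, $f\le_J g$ means $\{i<\kappa:\neg f(i)\le g(i)\}\in J$, similarly $<_J$; for a filter $D$ the order on $\prod\bar\lambda/D$ is modulo the dual ideal. $I^+=\mathcal P(\kappa)\setminus I$. A (quasi-)partial order $P$ is $\lambda$-directed if every $A\subseteq P$ with $|A|<\lambda$ has an upper bound in $P$. $\mathrm{tcf}(P)$ is the least $\lambda$ such that there is a strictly increasing sequence $\langle p_\alpha:\alpha<\lambda\rangle$ in $P$ with every $q\in P$ below some $p_\alpha$. $\liminf_{I}(\bar\lambda)=\min\{\mu:\{i<\kappa:\lambda_i\le\mu\}\in I^+\}$. $\mathrm{wsat}(I)$ is the least cardinal $\theta$ such that $\kappa$ cannot be partitioned into $\theta$ pairwise disjoint sets each in $I^+$. $\mathrm{pcf}(\bar\lambda)=\{\mathrm{tcf}(\prod\bar\lambda/D):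 D$ an ultrafilter on $\kappa$ with $D\cap I^*=\emptyset\}$. $J_{<\lambda}[\bar\lambda]=\{B\subseteq\kappa:$ there is no ultrafilter $D$ on $\kappa$ with $D\cap I^*=\emptyset$, $B\in D$ and $\mathrm{tcf}(\prod\bar\lambda/D)\ge\lambda\}$ (an ideal extending $I^*$), and $J_{\le\lambda}[\bar\lambda]=J_{<\lambda^+}[\bar\lambda]$. $\lambda\in\mathrm{pcf}(\bar\lambda)$ is semi-normal for $\bar\lambda$ if there are $B_\alpha\subseteq\kappa$ for $\alpha<\lambda$ such that (i) $\alpha<\beta$ implies $B_\alpha\setminus B_\beta\in J_{<\lambda}[\bar\lambda]$, and (ii) $J_{\le\lambda}[\bar\lambda]$ is the ideal generated by $J_{<\lambda}[\bar\lambda]\cup\{B_\alpha:\alpha<\lambda\}$. *)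

theory Defs
  imports Main "HOL.Hull" "HOL-Library.FuncSet" "HOL-Library.Disjoint_Sets"
begin

unbundle cardinal_syntax

text \<open>
  Cardinals are relations \<^term>\<open>r\<close> with \<^term>\<open>Card_order r\<close>, compared by the library relations
  \<open>\<le>o\<close>, \<open><o\<close>, \<open>=o\<close>, which also relate cardinals over different types; equality of cardinals is
  \<open>=o\<close>.  An element \<open>\<alpha> < r\<close> is an \<open>\<alpha> \<in> Field r\<close>.  The index set \<open>\<kappa>\<close> is the universe of a
  type \<open>'k\<close>, and all the \<open>\<lambda>\<^sub>i\<close> live on one type \<open>'a\<close>.
\<close>

text \<open>The least cardinal satisfying \<open>P\<close> (for \<open>P\<close> invariant under \<open>=o\<close>; determined up to \<open>=o\<close>).
  It ranges over cardinals on a fixed type, so each use below has to pick a type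
  that is large enough for the least cardinal to have a representative there.\<close>

definition least_card :: "('a rel \<Rightarrow> bool) \<Rightarrow> 'a rel" where
  "least_card P = (SOME r. Card_order r \<and> P r \<and> (\<forall>r'. Card_order r' \<and> P r' \<longrightarrow> r \<le>o r'))"

lemma least_card:
  assumes "Card_order r" "P r"
  shows "Card_order (least_card P) \<and> P (least_card P)
    \<and> (\<forall>r'. Card_order r' \<and> P r' \<longrightarrow> least_card P \<le>o r')"
proof -
  have "\<exists>s\<in>{r. Card_order r \<and> P r}. \<forall>r'\<in>{r. Card_order r \<and> P r}. s \<le>o r'"
    by (rule exists_minim_Card_order) (use assms in blast)+
  then have "\<exists>s. Card_order s \<and> P s \<and> (\<forall>r'. Card_order r' \<and> P r' \<longrightarrow> s \<le>o r')"
    by blast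
  then show ?thesis
    unfolding least_card_def by (rule someI_ex)
qed

definition is_ideal :: "'k set set \<Rightarrow> bool" where
  "is_ideal J \<longleftrightarrow> {} \<in> J \<and> (\<forall>A B. A \<in> J \<and> B \<subseteq> A \<longrightarrow> B \<in> J) \<and> (\<forall>A B. A \<in> J \<and> B \<in> J \<longrightarrow> A \<union> B \<in> J)"

definition proper_ideal :: "'k set set \<Rightarrow> bool" where
  "proper_ideal J \<longleftrightarrow> is_ideal J \<and> UNIV \<notin> J"

definition positive :: "'k set set \<Rightarrow> 'k set set" where
  "positive J = UNIV - J"

definition is_ultrafilter :: "'k set set \<Rightarrow> bool" where
  "is_ultrafilter D \<longleftrightarrow> UNIV \<in> D \<and> {} \<notin> D
     \<and> (\<forall>A B. A \<in> D \<and> A \<subseteq> B \<longrightarrow> B \<in> D) \<and> (\<forall>A B. A \<in> D \<and> B \<in> D \<longrightarrow> A \<inter> B \<in> D)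
     \<and> (\<forall>A. A \<in> D \<or> - A \<in> D)"

definition dual_ideal :: "'k set set \<Rightarrow> 'k set set" where
  "dual_ideal D = {- A | A. A \<in> D}"

definition card_prod :: "('k \<Rightarrow> 'a rel) \<Rightarrow> ('k \<Rightarrow> 'a) set" where
  "card_prod lam = (\<Pi> i\<in>UNIV. Field (lam i))"

definition le_mod :: "'k set set \<Rightarrow> ('k \<Rightarrow> 'a rel) \<Rightarrow> ('k \<Rightarrow> 'a) \<Rightarrow> ('k \<Rightarrow> 'a) \<Rightarrow> bool" where
  "le_mod J lam f g \<longleftrightarrow> {i. (f i, g i) \<notin> lam i} \<in> J"

definition directed :: "'c rel \<Rightarrow> 'p set \<Rightarrow> ('p \<Rightarrow> 'p \<Rightarrow> bool) \<Rightarrow> bool" where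
  "directed r P le \<longleftrightarrow> (\<forall>A\<subseteq>P. |A| <o r \<longrightarrow> (\<exists>u\<in>P. \<forall>a\<in>A. le a u))"

text \<open>True cofinality of the quasi-order \<open>(P, le)\<close>, with strict part \<open>x < y \<longleftrightarrow> x \<le> y \<and> \<not> y \<le> x\<close>
  (which is \<open><\<^sub>D\<close> when \<open>le\<close> is \<open>\<le>\<^sub>D\<close> for an ultrafilter \<open>D\<close>).  A strictly increasing sequence is
  injective, so cardinals on the type of the elements of \<open>P\<close> suffice.\<close>

definition tcf :: "'p set \<Rightarrow> ('p \<Rightarrow> 'p \<Rightarrow> bool) \<Rightarrow> 'p rel" where
  "tcf P le = least_card (\<lambda>r. \<exists>p. p ` Field r \<subseteq> P
     \<and> (\<forall>a b. (a, b) \<in> r \<and> a \<noteq> b \<longrightarrow> le (p a) (p b) \<and> \<not> le (p b) (p a))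
     \<and> (\<forall>q\<in>P. \<exists>a\<in>Field r. le q (p a)))"

definition tcf_mod :: "'k set set \<Rightarrow> ('k \<Rightarrow> 'a rel) \<Rightarrow> ('k \<Rightarrow> 'a) rel" where
  "tcf_mod D lam = tcf (card_prod lam) (le_mod (dual_ideal D) lam)"

text \<open>Every \<open>\<lambda>\<^sub>i\<close> is at most the cardinality of \<open>'a\<close>, so (for proper \<open>I\<close>) the least \<open>\<mu>\<close> is
  found on \<open>'a\<close>.\<close>

definition liminf_card :: "'k set set \<Rightarrow> ('k \<Rightarrow> 'a rel) \<Rightarrow> 'a rel" where
  "liminf_card I lam = least_card (\<lambda>mu. {i. lam i \<le>o mu} \<in> positive I)"

text \<open>The case \<open>\<theta> = 0\<close> has to be excluded, since a nonempty set is never partitioned into no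
  pieces.  A partition of \<open>\<kappa>\<close> has at most \<open>\<kappa>\<close> pieces, so the least \<open>\<theta>\<close> is at most
  \<open>\<kappa>\<^sup>+ \<le> 2\<^sup>\<kappa>\<close> and is found on \<open>'k set\<close>.\<close>

definition wsat :: "'k set set \<Rightarrow> 'k set rel" where
  "wsat I = least_card (\<lambda>theta. Field theta \<noteq> {} \<and>
     \<not> (\<exists>Q. partition_on UNIV Q \<and> Q \<subseteq> positive I \<and> |Q| =o theta))"

definition pcf :: "'k set set \<Rightarrow> ('k \<Rightarrow> 'a rel) \<Rightarrow> 'c rel set" where
  "pcf I lam = {mu. Card_order mu \<and>
     (\<exists>D. is_ultrafilter D \<and> D \<inter> I = {} \<and> mu =o tcf_mod D lam)}"

definition J_less :: "'c rel \<Rightarrow> 'k set set \<Rightarrow> ('k \<Rightarrow> 'a rel) \<Rightarrow> 'k set set" where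
  "J_less mu I lam = {B. \<not> (\<exists>D. is_ultrafilter D \<and> D \<inter> I = {} \<and> B \<in> D \<and> mu \<le>o tcf_mod D lam)}"

definition J_le :: "'c rel \<Rightarrow> 'k set set \<Rightarrow> ('k \<Rightarrow> 'a rel) \<Rightarrow> 'k set set" where
  "J_le mu I lam = J_less (cardSuc mu) I lam"

definition semi_normal :: "'c rel \<Rightarrow> 'k set set \<Rightarrow> ('k \<Rightarrow> 'a rel) \<Rightarrow> bool" where
  "semi_normal mu I lam \<longleftrightarrow> mu \<in> pcf I lam \<and>
     (\<exists>B :: 'c \<Rightarrow> 'k set.
        (\<forall>a b. (a, b) \<in> mu \<and> a \<noteq> b \<longrightarrow> B a - B b \<in> J_less mu I lam) \<and>
        J_le mu I lam = is_ideal hull (J_less mu I lam \<union> B ` Field mu))"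

end

theory Submission
  imports Defs
begin

text \<open>
  Either hypothesis on \<open>\<theta>\<close> has three consequences, which drive the proof: at most \<open>\<theta>\<close> members of
  \<open>\<Prod>\<lambda>\<^sub>i\<close> have a common upper bound modulo \<open>I\<close>; no family of \<open>\<theta>\<close> positive sets is pairwise disjoint;
  and for a proper initial segment \<open>S\<close> of \<open>\<theta>\<close> almost every \<open>\<lambda>\<^sub>i\<close> is larger than \<open>|S|\<close>.  The last
  one allows transfinite constructions of length \<open>\<theta>\<close> in the product: at stage \<open>\<xi>\<close> one can take true
  pointwise suprema of the earlier functions at every coordinate with \<open>\<lambda>\<^sub>i > |\<xi>|\<close>, that is, outside
  a set in \<open>I\<close>.

  Such constructions are the engine of the proof.  Suppose that a candidate \<open>a\<close> can always be refuted
  by some \<open>b\<close>, and that candidates \<open>a\<^sub>\<xi>\<close> with refutations \<open>b\<^sub>\<xi>\<close> are chosen so that \<open>a\<^sub>\<xi>\<close> lies above all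
  earlier \<open>b\<^sub>\<zeta>\<close>.  For a fixed function \<open>h\<close> the sets \<open>{i. a\<^sub>\<xi>(i) < h(i) \<le> b\<^sub>\<xi>(i)}\<close> are then pairwise
  disjoint up to sets in \<open>I\<close>, so one of them belongs to \<open>I\<close> (\<open>theta_exhaustion\<close>).  In each
  application every one of these sets belongs to an ultrafilter avoiding \<open>I\<close>, a contradiction; a
  single \<open>h\<close> works for all stages because the length of the sequences considered is regular and
  larger than \<open>\<theta>\<close>.

  The first application shows that \<open>\<Prod>\<lambda>\<^sub>i\<close> is \<open>\<mu>\<close>-directed modulo \<open>J\<^sub><\<^sub>\<mu>\<close> for every \<open>\<mu>\<close>
  (\<open>directed_J_less\<close>); consequently an ultrafilter avoiding \<open>J\<^sub><\<^sub>\<mu>\<close> has true cofinality at least \<open>\<mu>\<close>.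
  The second one yields a universal sequence \<open>\<langle>f\<^sub>\<alpha> : \<alpha> < \<mu>\<rangle>\<close>: it increases modulo \<open>J\<^sub><\<^sub>\<mu>\<close> and is cofinal
  modulo every ultrafilter of true cofinality \<open>\<mu>\<close> (\<open>universal_sequence\<close>).

  Directedness for \<open>\<mu>\<^sup>+\<close> provides an upper bound \<open>u\<close> of all \<open>f\<^sub>\<alpha>\<close> modulo \<open>J\<^sub>\<le>\<^sub>\<mu>\<close>.  The witnesses of
  semi-normality are \<open>B\<^sub>\<alpha> = {i. f\<^sub>\<alpha>(i) > u(i)}\<close>.  They increase modulo \<open>J\<^sub><\<^sub>\<mu>\<close> since the \<open>f\<^sub>\<alpha>\<close> do, and
  belong to \<open>J\<^sub>\<le>\<^sub>\<mu>\<close> by the choice of \<open>u\<close>.  If some \<open>X\<close> in \<open>J\<^sub>\<le>\<^sub>\<mu>\<close> were outside the ideal generated by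
  \<open>J\<^sub><\<^sub>\<mu>\<close> and the \<open>B\<^sub>\<alpha>\<close>, an ultrafilter containing \<open>X\<close> and avoiding that ideal would have true
  cofinality exactly \<open>\<mu>\<close>; then some \<open>f\<^sub>\<alpha>\<close> exceeds \<open>u\<close> modulo it and \<open>B\<^sub>\<alpha>\<close> belongs to it, which is
  impossible.
\<close>


section \<open>Ideals and ultrafilters\<close>

lemma ideal_subset: "is_ideal J \<Longrightarrow> A \<in> J \<Longrightarrow> B \<subseteq> A \<Longrightarrow> B \<in> J"
  unfolding is_ideal_def by (elim conjE) metis

lemma ideal_Un: "is_ideal J \<Longrightarrow> A \<in> J \<Longrightarrow> B \<in> J \<Longrightarrow> A \<union> B \<in> J"
  unfolding is_ideal_def by (elim conjE) metis

lemma ideal_empty: "is_ideal J \<Longrightarrow> {} \<in> J"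
  unfolding is_ideal_def by (elim conjE)

lemma is_ideal_hull: "is_ideal (is_ideal hull S)"
  by (rule hull_in) (auto simp: is_ideal_def)

lemma ultrafilter_UNIV: "is_ultrafilter D \<Longrightarrow> UNIV \<in> D"
  unfolding is_ultrafilter_def by (elim conjE)

lemma ultrafilter_superset: "is_ultrafilter D \<Longrightarrow> A \<in> D \<Longrightarrow> A \<subseteq> B \<Longrightarrow> B \<in> D"
  unfolding is_ultrafilter_def by (elim conjE) metis

lemma ultrafilter_Int: "is_ultrafilter D \<Longrightarrow> A \<in> D \<Longrightarrow> B \<in> D \<Longrightarrow> A \<inter> B \<in> D"
  unfolding is_ultrafilter_def by (elim conjE) metis

lemma ultrafilter_Compl: "is_ultrafilter D \<Longrightarrow> - A \<in> D \<longleftrightarrow> A \<notin> D"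
  unfolding is_ultrafilter_def by (elim conjE) (metis Compl_disjoint)

lemma ultrafilter_Un:
  assumes "is_ultrafilter D" "A \<union> B \<in> D" shows "A \<in> D \<or> B \<in> D"
proof (rule ccontr)
  assume "\<not> (A \<in> D \<or> B \<in> D)"
  then have "- A \<inter> - B \<in> D"
    using assms(1) by (simp add: ultrafilter_Compl ultrafilter_Int)
  then show False
    using assms ultrafilter_Compl[of D "A \<union> B"] by simp
qed

text \<open>Zorn's lemma gives an ideal \<open>M \<supseteq> J\<close> that is maximal among those omitting \<open>X\<close>.  Maximality makes it
  prime, so its complement is an ultrafilter.\<close>

lemma ultrafilter_avoiding_ideal:
  assumes J: "is_ideal J" and X: "X \<notin> J"
  obtains D where "is_ultrafilter D" "X \<in> D" "D \<inter> J = {}"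
proof -
  let ?A = "{K. is_ideal K \<and> J \<subseteq> K \<and> X \<notin> K}"
  obtain M where "M \<in> ?A" and Mmax: "\<forall>K\<in>?A. M \<subseteq> K \<longrightarrow> K = M"
  proof (atomize_elim, unfold Bex_def[symmetric], rule subset_Zorn_nonempty)
    show "?A \<noteq> {}" using J X by blast
    fix C assume ne: "C \<noteq> {}" and ch: "subset.chain ?A C"
    have C: "is_ideal K" "J \<subseteq> K" "X \<notin> K" if "K \<in> C" for K
      using ch that unfolding subset.chain_def by blast+
    have "is_ideal (\<Union> C)"
      unfolding is_ideal_def
    proof (intro conjI allI impI)
      show "{} \<in> \<Union> C" using ne C(1) ideal_empty by blast
    next
      fix A B assume "A \<in> \<Union> C \<and> B \<subseteq> A"
      then show "B \<in> \<Union> C" using C(1) ideal_subset[of _ A B] by blast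
    next
      fix A B assume "A \<in> \<Union> C \<and> B \<in> \<Union> C"
      then obtain K L where KL: "K \<in> C" "A \<in> K" "L \<in> C" "B \<in> L" by blast
      then have "K \<subseteq> L \<or> L \<subseteq> K" using ch unfolding subset.chain_def by blast
      then obtain N where "N \<in> C" "A \<in> N" "B \<in> N" using KL by blast
      then show "A \<union> B \<in> \<Union> C" using C(1) ideal_Un[of N A B] by blast
    qed
    moreover have "J \<subseteq> \<Union> C" using ne C(2) by blast
    moreover have "X \<notin> \<Union> C" using C(3) by blast
    ultimately show "\<Union> C \<in> ?A" by simp
  qed
  then have M: "is_ideal M" "J \<subseteq> M" "X \<notin> M" by simp_all
  have max: "K = M" if "is_ideal K" "J \<subseteq> K" "X \<notin> K" "M \<subseteq> K" for K
    using Mmax that by simp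
  \<comment> \<open>A set outside \<open>M\<close> generates, together with \<open>M\<close>, an ideal that contains \<open>X\<close>.\<close>
  have cover: "\<exists>N\<in>M. X \<subseteq> N \<union> A" if "A \<notin> M" for A
  proof (rule ccontr)
    assume no: "\<not> ?thesis"
    let ?K = "{B. \<exists>N\<in>M. B \<subseteq> N \<union> A}"
    have "is_ideal ?K"
      unfolding is_ideal_def
    proof (intro conjI allI impI)
      show "{} \<in> ?K" using ideal_empty[OF M(1)] by blast
    next
      fix B C assume "B \<in> ?K \<and> C \<subseteq> B"
      then show "C \<in> ?K" by blast
    next
      fix B C assume "B \<in> ?K \<and> C \<in> ?K"
      then obtain N N' where "N \<in> M" "N' \<in> M" "B \<subseteq> N \<union> A" "C \<subseteq> N' \<union> A" by blast
      then have "N \<union> N' \<in> M" "B \<union> C \<subseteq> (N \<union> N') \<union> A" using ideal_Un[OF M(1)] by auto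
      then show "B \<union> C \<in> ?K" by blast
    qed
    moreover have "M \<subseteq> ?K" by blast
    moreover have "X \<notin> ?K" using no by blast
    ultimately have "?K = M" using max[of ?K] M(2) by (metis (no_types, lifting) order_trans)
    moreover have "A \<in> ?K" using ideal_empty[OF M(1)] by blast
    ultimately show False using that by blast
  qed
  show thesis
  proof (rule that[of "- M"])
    show "is_ultrafilter (- M)"
      unfolding is_ultrafilter_def
    proof (intro conjI allI impI)
      show "UNIV \<in> - M" using ideal_subset[OF M(1), of UNIV X] M(3) by auto
      show "{} \<notin> - M" using ideal_empty[OF M(1)] by simp
    next
      fix A B assume "A \<in> - M \<and> A \<subseteq> B"
      then show "B \<in> - M" using ideal_subset[OF M(1), of B A] by auto
    next
      fix A B assume "A \<in> - M \<and> B \<in> - M"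
      then obtain N N' where N: "N \<in> M" "N' \<in> M" "X \<subseteq> N \<union> A" "X \<subseteq> N' \<union> B"
        using cover by (metis ComplD)
      show "A \<inter> B \<in> - M"
      proof
        assume "A \<inter> B \<in> M"
        then have "N \<union> N' \<union> (A \<inter> B) \<in> M" using N M(1) by (simp add: ideal_Un)
        moreover have "X \<subseteq> N \<union> N' \<union> (A \<inter> B)" using N by blast
        ultimately show False using ideal_subset[OF M(1)] M(3) by metis
      qed
    next
      fix A
      have "\<not> (A \<in> M \<and> - A \<in> M)"
        using ideal_Un[OF M(1), of A "- A"] ideal_subset[OF M(1), of UNIV X] M(3)
        by auto
      then show "A \<in> - M \<or> - A \<in> - M" by blast
    qed
  qed (use M in auto)
qed

section \<open>Well-orders\<close>

text \<open>Recursion in which the value at \<open>x\<close> is an arbitrary solution \<open>y\<close> of a condition \<open>Q x g y\<close> on the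
  values \<open>g\<close> below \<open>x\<close>; solutions have to exist only when the earlier values are solutions
  themselves.\<close>

lemma wf_recursive_choice:
  assumes wf: "wf R"
    and local: "\<And>g h x y. (\<And>z. (z, x) \<in> R \<Longrightarrow> g z = h z) \<Longrightarrow> Q x g y \<longleftrightarrow> Q x h y"
    and step: "\<And>x g. (\<And>z. (z, x) \<in> R \<Longrightarrow> Q z g (g z)) \<Longrightarrow> \<exists>y. Q x g y"
  shows "\<exists>f. \<forall>x. Q x f (f x)"
proof -
  define f where "f = wfrec R (\<lambda>g x. SOME y. Q x g y)"
  have f: "f x = (SOME y. Q x f y)" for x
  proof -
    have "f x = (SOME y. Q x (cut f R x) y)"
      unfolding f_def by (rule wfrec[OF wf])
    also have "\<dots> = (SOME y. Q x f y)"
      using local[of x "cut f R x" f] by (simp add: cut_apply)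
    finally show ?thesis .
  qed
  have "Q x f (f x)" for x
    using wf
  proof (induction x rule: wf_induct_rule)
    case (less x)
    then show ?case using step[of x f] f[of x] by (metis someI_ex)
  qed
  then show ?thesis by blast
qed

lemma wf_Card_order: "Card_order r \<Longrightarrow> wf (r - Id)"
  unfolding card_order_on_def well_order_on_def by blast

lemma Card_order_refl: "Card_order r \<Longrightarrow> x \<in> Field r \<Longrightarrow> (x, x) \<in> r"
  by (auto simp: card_order_on_def order_on_defs refl_on_def)

lemma Card_order_transD: "Card_order r \<Longrightarrow> (x, y) \<in> r \<Longrightarrow> (y, z) \<in> r \<Longrightarrow> (x, z) \<in> r"
  by (auto simp: card_order_on_def order_on_defs dest: transD)

lemma Card_order_antisym: "Card_order r \<Longrightarrow> (x, y) \<in> r \<Longrightarrow> (y, x) \<in> r \<Longrightarrow> x = y"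
  by (auto simp: card_order_on_def order_on_defs dest: antisymD)

lemma Card_order_total:
  "Card_order r \<Longrightarrow> x \<in> Field r \<Longrightarrow> y \<in> Field r \<Longrightarrow> (x, y) \<in> r \<or> (y, x) \<in> r"
  using Card_order_refl[of r x]
  by (cases "x = y") (auto simp: card_order_on_def order_on_defs total_on_def)

lemma regularCard_bounded:
  assumes r: "Card_order r" "regularCard r" and K: "K \<subseteq> Field r" "|K| <o r"
  shows "\<exists>u\<in>Field r. \<forall>x\<in>K. (x, u) \<in> r"
proof -
  have "\<not> cofinal K r"
    using r K unfolding regularCard_def by (meson not_ordLess_ordIso)
  then obtain u where "u \<in> Field r" "\<And>x. x \<in> K \<Longrightarrow> u = x \<or> (u, x) \<notin> r"
    unfolding cofinal_def by blast
  moreover from this have "(x, u) \<in> r" if "x \<in> K" for x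
    using that Card_order_total[OF r(1), of u x] Card_order_refl[OF r(1), of u] K(1) by blast
  ultimately show ?thesis by blast
qed

lemma card_image_less: "|A| <o r \<Longrightarrow> |f ` A| <o r"
  by (rule ordLeq_ordLess_trans[OF card_of_image])

section \<open>Cofinal sequences in total preorders\<close>

definition is_scale :: "'c rel \<Rightarrow> 'p set \<Rightarrow> ('p \<Rightarrow> 'p \<Rightarrow> bool) \<Rightarrow> ('c \<Rightarrow> 'p) \<Rightarrow> bool" where
  "is_scale r P le p \<longleftrightarrow> p ` Field r \<subseteq> P
     \<and> (\<forall>a b. (a, b) \<in> r \<and> a \<noteq> b \<longrightarrow> le (p a) (p b) \<and> \<not> le (p b) (p a))
     \<and> (\<forall>q\<in>P. \<exists>a\<in>Field r. le q (p a))"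

locale total_preorder_set =
  fixes P :: "'p set" and le :: "'p \<Rightarrow> 'p \<Rightarrow> bool"
  assumes refl: "x \<in> P \<Longrightarrow> le x x"
    and trans: "x \<in> P \<Longrightarrow> y \<in> P \<Longrightarrow> z \<in> P \<Longrightarrow> le x y \<Longrightarrow> le y z \<Longrightarrow> le x z"
    and total: "x \<in> P \<Longrightarrow> y \<in> P \<Longrightarrow> le x y \<or> le y x"
begin

text \<open>Run through a cofinal set \<open>G\<close> of least size in the order type \<open>|G|\<close>, putting the value at stage \<open>x\<close>
  above \<open>x\<close>.  The values chosen before stage \<open>x\<close> are fewer than \<open>|G|\<close>, hence not cofinal, and by
  totality some element is strictly above all of them and also above \<open>x\<close>.\<close>

lemma scale_below_cofinal:
  assumes F: "F \<subseteq> P" "\<And>q. q \<in> P \<Longrightarrow> \<exists>f\<in>F. le q f"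
  obtains r :: "'p rel" and p where "Card_order r" "r \<le>o |F|" "is_scale r P le p"
proof -
  let ?R = "{|G| | G. G \<subseteq> P \<and> (\<forall>q\<in>P. \<exists>f\<in>G. le q f)}"
  have "\<exists>r\<in>?R. \<forall>r'\<in>?R. r \<le>o r'"
    by (rule exists_minim_Card_order) (use F in \<open>auto simp: card_of_Card_order\<close>)
  then obtain r where r: "r \<in> ?R" "\<forall>r'\<in>?R. r \<le>o r'" by (rule bexE)
  then obtain G where G: "r = |G|" "G \<subseteq> P" "\<And>q. q \<in> P \<Longrightarrow> \<exists>f\<in>G. le q f" by auto
  have min: "|G| \<le>o |H|" if "H \<subseteq> P" "\<And>q. q \<in> P \<Longrightarrow> \<exists>f\<in>H. le q f" for H
  proof -
    have "|H| \<in> ?R" using that by blast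
    then show ?thesis using r(2) G(1) by blast
  qed
  note G = G(2,3)
  let ?r = "|G|"
  have r: "Card_order ?r" "Field ?r = G" by (rule card_of_Card_order, rule Field_card_of)
  let ?Q = "\<lambda>x g y. x \<in> G \<longrightarrow> y \<in> P \<and> le x y
    \<and> (\<forall>z. (z, x) \<in> ?r - Id \<longrightarrow> le (g z) y \<and> \<not> le y (g z))"
  have "\<exists>p. \<forall>x. ?Q x p (p x)"
  proof (rule wf_recursive_choice[OF wf_Card_order[OF r(1)]])
    fix x and g :: "'p \<Rightarrow> 'p"
    assume IH: "\<And>z. (z, x) \<in> ?r - Id \<Longrightarrow> ?Q z g (g z)"
    show "\<exists>y. ?Q x g y"
    proof (cases "x \<in> G")
      case True
      let ?S = "underS ?r x"
      have SG: "?S \<subseteq> G" using r(2) unfolding underS_def Field_def by blast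
      have S: "g ` ?S \<subseteq> P" using IH SG by (force simp: underS_def)
      have "|g ` ?S| <o |G|"
        by (intro card_image_less card_of_underS r(1)) (simp only: True r(2))
      \<comment> \<open>By the minimality of \<open>G\<close> fewer than \<open>|G|\<close> elements are not cofinal.\<close>
      then obtain q where q: "q \<in> P" "\<And>f. f \<in> g ` ?S \<Longrightarrow> \<not> le q f"
        using min[OF S] not_ordLess_ordLeq by blast
      have xP: "x \<in> P" using True G by blast
      define y where "y = (if le x q then q else x)"
      have y: "y \<in> P" "le x y" "le q y"
        using q(1) xP total[OF xP q(1)] refl unfolding y_def by auto
      have "le (g z) y \<and> \<not> le y (g z)" if "z \<in> ?S" for z
      proof -
        have gz: "g z \<in> P" "\<not> le q (g z)" using that S q(2) by auto
        then have "le (g z) q" using total q(1) by blast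
        then show ?thesis using gz y q(1) trans by blast
      qed
      then show ?thesis using y by (intro exI[of _ y]) (auto simp: underS_def)
    qed simp
  qed auto
  then obtain p where p: "\<And>x. ?Q x p (p x)" by blast
  have "is_scale ?r P le p"
    unfolding is_scale_def
  proof (intro conjI allI impI ballI)
    show "p ` Field ?r \<subseteq> P" using p r(2) by auto
  next
    fix a b assume ab: "(a, b) \<in> ?r \<and> a \<noteq> b"
    then have "b \<in> G" using r(2) unfolding Field_def by blast
    then show "le (p a) (p b)" "\<not> le (p b) (p a)" using p[of b] ab by auto
  next
    fix q assume q: "q \<in> P"
    then obtain x where "x \<in> G" "le q x" using G(2) by blast
    moreover from this have "le x (p x)" "p x \<in> P" "x \<in> P" using p G(1) by auto
    ultimately have "le q (p x)" using q trans by blast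
    then show "\<exists>a\<in>Field ?r. le q (p a)" using \<open>x \<in> G\<close> r(2) by (intro bexI) auto
  qed
  from r(1) min[OF F] this show thesis by (rule that)
qed

text \<open>The constant \<open>tcf\<close> is a choice among the least lengths of scales, so it is meaningful only once a
  scale is known to exist, which totality guarantees.\<close>

lemma Card_order_tcf: "Card_order (tcf P le)"
  and tcf_scale: "\<exists>p. is_scale (tcf P le) P le p"
  and tcf_le_cofinal: "F \<subseteq> P \<Longrightarrow> (\<And>q. q \<in> P \<Longrightarrow> \<exists>f\<in>F. le q f) \<Longrightarrow> tcf P le \<le>o |F|"
proof -
  let ?W = "\<lambda>r :: 'p rel. \<exists>p. is_scale r P le p"
  \<comment> \<open>The length condition in the definition of \<open>tcf\<close> is the existence of a scale.\<close>
  have tcf: "tcf P le = least_card ?W"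
    unfolding tcf_def is_scale_def ..
  note lc = least_card[of _ ?W, folded tcf]
  obtain r :: "'p rel" and p where "Card_order r" "is_scale r P le p"
    using scale_below_cofinal[of P] refl by blast
  then show "Card_order (tcf P le)" "?W (tcf P le)" using lc by blast+
  assume "F \<subseteq> P" "\<And>q. q \<in> P \<Longrightarrow> \<exists>f\<in>F. le q f"
  then obtain s :: "'p rel" and p where s: "Card_order s" "s \<le>o |F|" "is_scale s P le p"
    using scale_below_cofinal[of F] by blast
  then have "tcf P le \<le>o s" using lc[of s] by blast
  then show "tcf P le \<le>o |F|" using s(2) ordLeq_transitive by blast
qed

end

section \<open>Products of regular cardinals modulo ultrafilters\<close>

lemma le_mod_dual_ideal:
  "le_mod (dual_ideal D) lam f g \<longleftrightarrow> {i. (f i, g i) \<in> lam i} \<in> D"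
proof -
  have "{i. (f i, g i) \<notin> lam i} \<in> dual_ideal D \<longleftrightarrow> - {i. (f i, g i) \<notin> lam i} \<in> D"
    unfolding dual_ideal_def by (auto intro!: exI[of _ "- {i. (f i, g i) \<notin> lam i}"])
  also have "- {i. (f i, g i) \<notin> lam i} = {i. (f i, g i) \<in> lam i}" by blast
  finally show ?thesis unfolding le_mod_def .
qed

locale regular_product =
  fixes lam :: "'k \<Rightarrow> 'a rel" and I :: "'k set set"
  assumes proper: "proper_ideal I"
    and regular: "Cinfinite (lam i) \<and> regularCard (lam i)"
begin

abbreviation P :: "('k \<Rightarrow> 'a) set" where "P \<equiv> card_prod lam"

definition admissible :: "'k set set \<Rightarrow> bool" where
  "admissible D \<longleftrightarrow> is_ultrafilter D \<and> D \<inter> I = {}"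

abbreviation le_uf :: "'k set set \<Rightarrow> ('k \<Rightarrow> 'a) \<Rightarrow> ('k \<Rightarrow> 'a) \<Rightarrow> bool" where
  "le_uf D f g \<equiv> {i. (f i, g i) \<in> lam i} \<in> D"

lemma ideal_I: "is_ideal I"
  using proper unfolding proper_ideal_def by blast

lemma card_lam: "Card_order (lam i)"
  using regular by blast

lemma in_P_iff: "f \<in> P \<longleftrightarrow> (\<forall>i. f i \<in> Field (lam i))"
  unfolding card_prod_def by auto

lemma in_Field: "f \<in> P \<Longrightarrow> f i \<in> Field (lam i)"
  by (simp add: in_P_iff)

lemma P_nonempty: obtains f where "f \<in> P"
proof -
  have "\<exists>x. x \<in> Field (lam i)" for i
    using regular[of i] unfolding cinfinite_def by (metis finite.emptyI ex_in_conv)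
  then have "\<exists>f. \<forall>i. f i \<in> Field (lam i)" by metis
  then show thesis using that in_P_iff by blast
qed

text \<open>Strict inequality in the linear order \<open>lam i\<close> is written as failure of the reverse inequality.  An
  infinite cardinal has no greatest element, which gives a larger value at every coordinate.\<close>

lemma P_strictly_above:
  assumes "f \<in> P" obtains g where "g \<in> P" "\<And>i. (g i, f i) \<notin> lam i"
proof -
  have "\<exists>y\<in>Field (lam i). (y, f i) \<notin> lam i" for i
  proof -
    obtain y where "y \<in> Field (lam i)" "f i \<noteq> y" "(f i, y) \<in> lam i"
      using infinite_Card_order_limit[OF card_lam, of i "f i"] regular[of i] in_Field[OF assms]
      unfolding cinfinite_def by blast
    then show ?thesis using Card_order_antisym[OF card_lam] by blast
  qed
  then have "\<exists>g. \<forall>i. g i \<in> Field (lam i) \<and> (g i, f i) \<notin> lam i" by metis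
  then show thesis using that in_P_iff by blast
qed

lemma P_max:
  assumes "f \<in> P" "g \<in> P"
  obtains h where "h \<in> P" "\<And>i. (f i, h i) \<in> lam i" "\<And>i. (g i, h i) \<in> lam i"
proof -
  have "\<exists>y\<in>Field (lam i). (f i, y) \<in> lam i \<and> (g i, y) \<in> lam i" for i
    using Card_order_total[OF card_lam, of "f i" i "g i"] Card_order_refl[OF card_lam]
      assms in_Field by blast
  then have "\<exists>h. \<forall>i. h i \<in> Field (lam i) \<and> (f i, h i) \<in> lam i \<and> (g i, h i) \<in> lam i" by metis
  then show thesis using that in_P_iff by blast
qed

lemma bounded_at:
  assumes "K \<subseteq> Field (lam i)" "|K| <o lam i"
  shows "\<exists>u\<in>Field (lam i). \<forall>x\<in>K. (x, u) \<in> lam i"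
  by (rule regularCard_bounded[OF card_lam conjunct2[OF regular] assms])

lemma le_mod_refl: "is_ideal J \<Longrightarrow> f \<in> P \<Longrightarrow> le_mod J lam f f"
  unfolding le_mod_def by (simp add: Card_order_refl[OF card_lam] in_Field ideal_empty)

lemma le_mod_trans:
  assumes J: "is_ideal J" and "le_mod J lam f g" "le_mod J lam g h"
  shows "le_mod J lam f h"
proof -
  have "{i. (f i, h i) \<notin> lam i} \<subseteq> {i. (f i, g i) \<notin> lam i} \<union> {i. (g i, h i) \<notin> lam i}"
    using Card_order_transD[OF card_lam] by blast
  moreover have "\<dots> \<in> J"
    using assms unfolding le_mod_def by (simp add: ideal_Un)
  ultimately show ?thesis unfolding le_mod_def by (rule ideal_subset[OF J, rotated])
qed

lemma le_mod_pointwise: "is_ideal J \<Longrightarrow> (\<And>i. (f i, g i) \<in> lam i) \<Longrightarrow> le_mod J lam f g"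
  unfolding le_mod_def by (simp add: ideal_empty)

lemma le_mod_mono: "J \<subseteq> K \<Longrightarrow> le_mod J lam f g \<Longrightarrow> le_mod K lam f g"
  unfolding le_mod_def by blast

lemma le_uf_of_le_mod:
  assumes "is_ultrafilter D" "D \<inter> J = {}" "le_mod J lam f g" shows "le_uf D f g"
proof -
  have "- {i. (f i, g i) \<in> lam i} \<notin> D"
    using assms(2,3) unfolding le_mod_def Compl_eq by auto
  then show ?thesis
    using ultrafilter_Compl[OF assms(1), of "{i. (f i, g i) \<in> lam i}"] by simp
qed

lemma le_uf_trans:
  assumes D: "is_ultrafilter D" and "le_uf D f g" "le_uf D g h" shows "le_uf D f h"
proof -
  have "{i. (f i, g i) \<in> lam i} \<inter> {i. (g i, h i) \<in> lam i} \<subseteq> {i. (f i, h i) \<in> lam i}"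
    using Card_order_transD[OF card_lam] by blast
  then show ?thesis
    by (rule ultrafilter_superset[OF D ultrafilter_Int[OF D assms(2,3)]])
qed

lemma le_uf_total:
  assumes D: "is_ultrafilter D" and "f \<in> P" "g \<in> P" shows "le_uf D f g \<or> le_uf D g f"
proof -
  have "{i. (f i, g i) \<in> lam i} \<union> {i. (g i, f i) \<in> lam i} = UNIV"
    using Card_order_total[OF card_lam] in_Field assms(2,3) by blast
  then show ?thesis using ultrafilter_Un[OF D] ultrafilter_UNIV[OF D] by metis
qed

lemma not_le_uf:
  assumes "is_ultrafilter D" shows "\<not> le_uf D f g \<longleftrightarrow> {i. (f i, g i) \<notin> lam i} \<in> D"
  using ultrafilter_Compl[OF assms, of "{i. (f i, g i) \<in> lam i}"] unfolding Compl_eq by simp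

lemma total_preorder_ultraproduct:
  assumes D: "is_ultrafilter D"
  shows "total_preorder_set P (le_mod (dual_ideal D) lam)"
proof
  show "le_mod (dual_ideal D) lam f f" if "f \<in> P" for f
    using that le_uf_total[OF D, of f f] unfolding le_mod_dual_ideal by simp
  show "le_mod (dual_ideal D) lam f h"
    if "le_mod (dual_ideal D) lam f g" "le_mod (dual_ideal D) lam g h" for f g h
    using that unfolding le_mod_dual_ideal by (rule le_uf_trans[OF D])
  show "le_mod (dual_ideal D) lam f g \<or> le_mod (dual_ideal D) lam g f"
    if "f \<in> P" "g \<in> P" for f g
    using that unfolding le_mod_dual_ideal by (rule le_uf_total[OF D])
qed

lemma Card_order_tcf_mod: "is_ultrafilter D \<Longrightarrow> Card_order (tcf_mod D lam)"
  unfolding tcf_mod_def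
  by (rule total_preorder_set.Card_order_tcf[OF total_preorder_ultraproduct])

text \<open>The scale provided by \<open>tcf\<close> is indexed by a cardinal on the type of functions; it is pulled back
  along an order isomorphism to the given representative \<open>mu\<close> of that cardinal.\<close>

lemma scale_of_length_tcf:
  fixes mu :: "'c rel"
  assumes D: "is_ultrafilter D" and mu: "mu =o tcf_mod D lam"
  shows "\<exists>k. (\<forall>a\<in>Field mu. k a \<in> P) \<and> (\<forall>a b. (a, b) \<in> mu \<longrightarrow> le_uf D (k a) (k b))
    \<and> (\<forall>h\<in>P. \<exists>a\<in>Field mu. le_uf D h (k a))"
proof -
  let ?r = "tcf_mod D lam"
  obtain p where p: "is_scale ?r P (le_mod (dual_ideal D) lam) p"
    unfolding tcf_mod_def
    using total_preorder_set.tcf_scale[OF total_preorder_ultraproduct[OF D]] ..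
  obtain e where e: "iso mu ?r e" using mu unfolding ordIso_def by blast
  have wo: "Well_order mu" using mu unfolding ordIso_def by blast
  have bij: "bij_betw e (Field mu) (Field ?r)" using e unfolding iso_def by blast
  have p_P: "p c \<in> P" if "c \<in> Field ?r" for c
    using p that unfolding is_scale_def by blast
  have p_le: "le_uf D (p c) (p d)" if "(c, d) \<in> ?r" "c \<noteq> d" for c d
    using p that unfolding is_scale_def le_mod_dual_ideal by simp
  have p_cofinal: "\<exists>c\<in>Field ?r. le_uf D h (p c)" if "h \<in> P" for h
    using p that unfolding is_scale_def le_mod_dual_ideal by simp
  have mono: "(e a, e b) \<in> ?r" if "(a, b) \<in> mu" for a b
    using e wo that embed_compat[of mu ?r e] unfolding iso_def compat_def by blast
  show ?thesis
  proof (intro exI[of _ "\<lambda>a. p (e a)"] conjI ballI allI impI)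
    show P: "p (e a) \<in> P" if "a \<in> Field mu" for a
      using that bij p_P unfolding bij_betw_def by blast
    show "le_uf D (p (e a)) (p (e b))" if "(a, b) \<in> mu" for a b
    proof (cases "e a = e b")
      case True
      have "p (e a) \<in> P" using P that by (meson FieldI1)
      then show ?thesis using True le_uf_total[OF D, of "p (e a)" "p (e a)"] by simp
    next
      case False
      then show ?thesis using mono[OF that] p_le by simp
    qed
    show "\<exists>a\<in>Field mu. le_uf D h (p (e a))" if "h \<in> P" for h
    proof -
      obtain c where "c \<in> Field ?r" "le_uf D h (p c)"
        using p_cofinal[OF \<open>h \<in> P\<close>] by (rule bexE)
      moreover from this obtain a where "a \<in> Field mu" "c = e a"
        using bij unfolding bij_betw_def by blast
      ultimately show ?thesis by auto
    qed
  qed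
qed

text \<open>In a total preorder a set without an upper bound is cofinal, and cofinal sets have at least \<open>tcf\<close>
  elements.\<close>

lemma bounded_below_tcf:
  assumes D: "is_ultrafilter D" and F: "F \<subseteq> P" "|F| <o tcf_mod D lam"
  shows "\<exists>u\<in>P. \<forall>f\<in>F. le_uf D f u"
proof -
  have "\<not> tcf_mod D lam \<le>o |F|" using F(2) not_ordLess_ordLeq by blast
  then obtain q where q: "q \<in> P" "\<And>f. f \<in> F \<Longrightarrow> \<not> le_mod (dual_ideal D) lam q f"
    unfolding tcf_mod_def
    using total_preorder_set.tcf_le_cofinal[OF total_preorder_ultraproduct[OF D] F(1)] by blast
  have "le_uf D f q" if "f \<in> F" for f
    using q(2)[OF that] le_uf_total[OF D q(1), of f] F(1) that
    unfolding le_mod_dual_ideal by blast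
  then show ?thesis using q(1) by auto
qed

text \<open>Ultraproducts have no greatest element, because \<open>P_strictly_above\<close> moves every function up at all
  coordinates.  So the range of a scale is unbounded, and its length exceeds \<open>r\<close> as soon as all sets
  of size at most \<open>r\<close> are bounded.\<close>

lemma tcf_not_le_bounded:
  assumes D: "is_ultrafilter D" and r: "Card_order r"
    and bdd: "\<And>F. F \<subseteq> P \<Longrightarrow> |F| \<le>o r \<Longrightarrow> \<exists>u\<in>P. \<forall>f\<in>F. le_uf D f u"
  shows "r <o tcf_mod D lam"
proof (rule ccontr)
  let ?t = "tcf_mod D lam"
  assume "\<not> r <o ?t"
  then have le: "?t \<le>o r"
    using ordLess_or_ordLeq[OF card_order_on_well_order_on[OF r]
        card_order_on_well_order_on[OF Card_order_tcf_mod[OF D]]] by simp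
  have "?t =o ?t"
    by (rule ordIso_reflexive[OF card_order_on_well_order_on[OF Card_order_tcf_mod[OF D]]])
  from scale_of_length_tcf[OF D this] obtain k where
    kP: "\<forall>a\<in>Field ?t. k a \<in> P" and cof: "\<forall>h\<in>P. \<exists>a\<in>Field ?t. le_uf D h (k a)"
    by (elim exE conjE)
  have "|k ` Field ?t| \<le>o |Field ?t|" by (rule card_of_image)
  also have "|Field ?t| =o ?t" by (rule card_of_Field_ordIso[OF Card_order_tcf_mod[OF D]])
  finally have "|k ` Field ?t| \<le>o r" using le ordLeq_transitive by blast
  then obtain u where u: "u \<in> P" "\<And>a. a \<in> Field ?t \<Longrightarrow> le_uf D (k a) u"
    using bdd[of "k ` Field ?t"] kP by auto
  obtain v where v: "v \<in> P" "\<And>i. (v i, u i) \<notin> lam i" using P_strictly_above[OF u(1)] by metis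
  obtain a where "a \<in> Field ?t" "le_uf D v (k a)" using bspec[OF cof v(1)] by (rule bexE)
  then have "le_uf D v u" using u(2) le_uf_trans[OF D] by simp
  then show False using v(2) D unfolding is_ultrafilter_def by simp
qed

section \<open>The ideals \<open>J\<^sub><\<^sub>\<mu>\<close>\<close>

lemma J_less_iff: "B \<in> J_less mu I lam \<longleftrightarrow> \<not> (\<exists>D. admissible D \<and> B \<in> D \<and> mu \<le>o tcf_mod D lam)"
  unfolding J_less_def admissible_def by auto

lemma J_less_ideal: "is_ideal (J_less mu I lam)"
proof -
  have "A \<union> B \<in> J_less mu I lam" if "A \<in> J_less mu I lam" "B \<in> J_less mu I lam" for A B
    using that ultrafilter_Un[of _ A B] unfolding J_less_iff admissible_def by blast
  moreover have "B \<in> J_less mu I lam" if "A \<in> J_less mu I lam" "B \<subseteq> A" for A B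
    using that ultrafilter_superset[of _ B A]
    unfolding J_less_iff admissible_def by blast
  moreover have "{} \<in> J_less mu I lam"
    unfolding J_less_iff admissible_def is_ultrafilter_def by simp
  ultimately show ?thesis unfolding is_ideal_def by metis
qed

lemma I_subset_J_less: "I \<subseteq> J_less mu I lam"
  unfolding J_less_def by blast

lemma disjoint_J_less:
  assumes "admissible D" "mu \<le>o tcf_mod D lam" shows "D \<inter> J_less mu I lam = {}"
  using assms J_less_iff by blast

lemma finite_bounded:
  assumes J: "is_ideal J" and "finite F" "F \<subseteq> P"
  shows "\<exists>u\<in>P. \<forall>f\<in>F. le_mod J lam f u"
  using assms(2,3)
proof (induction F)
  case empty
  then show ?case using P_nonempty by auto
next
  case (insert g F)
  then obtain u where u: "u \<in> P" "\<And>f. f \<in> F \<Longrightarrow> le_mod J lam f u" by auto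
  have "g \<in> P" using insert.prems by simp
  then obtain v where v: "v \<in> P" "\<And>i. (g i, v i) \<in> lam i" "\<And>i. (u i, v i) \<in> lam i"
    using P_max[of g u] u(1) by metis
  have "le_mod J lam f v" if "f \<in> F" for f
    by (rule le_mod_trans[OF J u(2)[OF that] le_mod_pointwise[OF J v(3)]])
  moreover have "le_mod J lam g v" by (rule le_mod_pointwise[OF J v(2)])
  ultimately show ?case using v(1) by auto
qed

text \<open>A sequence of functions is turned into one that increases modulo \<open>J\<close>, at the price of moving its
  terms up.  The new terms dominate the old ones everywhere and not only modulo \<open>J\<close>, as required by
  the steps of \<open>theta_exhaustion\<close>.\<close>

lemma increasing_majorant:
  fixes r :: "'c rel"
  assumes r: "Card_order r"
    and J: "is_ideal J"
    and bdd: "\<And>F. F \<subseteq> P \<Longrightarrow> |F| <o r \<Longrightarrow> \<exists>u\<in>P. \<forall>f\<in>F. le_mod J lam f u"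
    and s: "\<And>a. s a \<in> P"
  obtains f where "\<And>a. f a \<in> P" "\<And>a i. (s a i, f a i) \<in> lam i"
    "\<And>a b. (a, b) \<in> r \<Longrightarrow> le_mod J lam (f a) (f b)"
proof -
  let ?Q = "\<lambda>x g y. y \<in> P \<and> (\<forall>i. (s x i, y i) \<in> lam i)
    \<and> (\<forall>z. (z, x) \<in> r - Id \<longrightarrow> le_mod J lam (g z) y)"
  have "\<exists>f. \<forall>x. ?Q x f (f x)"
  proof (rule wf_recursive_choice[OF wf_Card_order[OF r]])
    fix x and g :: "'c \<Rightarrow> 'k \<Rightarrow> 'a"
    assume IH: "\<And>z. (z, x) \<in> r - Id \<Longrightarrow> ?Q z g (g z)"
    have gP: "g ` underS r x \<subseteq> P" using IH unfolding underS_def by blast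
    have "\<exists>u\<in>P. \<forall>f\<in>g ` underS r x. le_mod J lam f u"
    proof (cases "x \<in> Field r")
      case True
      then show ?thesis using bdd[OF gP] card_image_less[OF card_of_underS[OF r]] by blast
    next
      case False
      then have "underS r x = {}" unfolding underS_def Field_def by blast
      then show ?thesis using P_nonempty by blast
    qed
    then obtain u where u: "u \<in> P" "\<And>z. z \<in> underS r x \<Longrightarrow> le_mod J lam (g z) u" by auto
    obtain y where y: "y \<in> P" "\<And>i. (s x i, y i) \<in> lam i" "\<And>i. (u i, y i) \<in> lam i"
      using P_max[OF s u(1)] by blast
    have "le_mod J lam (g z) y" if "(z, x) \<in> r - Id" for z
      by (rule le_mod_trans[OF J u(2) le_mod_pointwise[OF J y(3)]])
        (use that in \<open>simp add: underS_def\<close>)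
    then show "\<exists>y. ?Q x g y" using y by blast
  qed auto
  then obtain f where f: "\<And>x. ?Q x f (f x)" by blast
  show thesis
  proof (rule that[of f])
    show "le_mod J lam (f a) (f b)" if "(a, b) \<in> r" for a b
      using f that le_mod_refl[OF J] by (cases "a = b") auto
  qed (use f in auto)
qed

end

section \<open>Few positive sets force termination\<close>

text \<open>The common ground of the two alternatives for \<open>\<theta>\<close>.  If every \<open>\<lambda>\<^sub>i\<close> is larger than \<open>\<theta>\<close>, the sets in
  \<open>small_lam\<close> are empty, and regularity of the \<open>\<lambda>\<^sub>i\<close> gives \<open>theta_bounded\<close> coordinate by coordinate.
  Otherwise \<open>small_lam\<close> expresses that \<open>\<theta>\<close> is at most the limit inferior.\<close>

locale pcf_setting = regular_product lam I
  for lam :: "'k \<Rightarrow> 'a rel" and I :: "'k set set" +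
  fixes theta :: "'t rel"
  assumes card_theta: "Card_order theta"
    and small_lam: "x \<in> Field theta \<Longrightarrow> {i. lam i \<le>o |underS theta x|} \<in> I"
    and theta_bounded: "F \<subseteq> P \<Longrightarrow> |F| \<le>o theta \<Longrightarrow> \<exists>u\<in>P. \<forall>f\<in>F. le_mod I lam f u"
    and saturated: "(\<And>x. x \<in> Field theta \<Longrightarrow> E x \<notin> I)
      \<Longrightarrow> \<exists>x\<in>Field theta. \<exists>y\<in>Field theta. x \<noteq> y \<and> E x \<inter> E y \<noteq> {}"
begin

text \<open>The index \<open>c\<close> allows a stage to be a whole sequence of functions.  At stage \<open>x\<close> the candidate
  \<open>a x\<close> is put above all earlier refutations \<open>b z\<close>, at the coordinates \<open>i\<close> where \<open>\<lambda>\<^sub>i\<close> has more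
  elements than there are earlier stages; there regularity of \<open>\<lambda>\<^sub>i\<close> bounds their values.  For
  \<open>z < x\<close> such a coordinate cannot satisfy both \<open>h i \<le> b z c i\<close> and \<open>a x c i < h i\<close>.  After
  removal of the remaining coordinates, which form a set in \<open>I\<close>, the sets in the conclusion are
  therefore disjoint, and they cannot all be positive.\<close>

lemma theta_exhaustion:
  fixes \<Phi> :: "('c \<Rightarrow> 'k \<Rightarrow> 'a) \<Rightarrow> ('c \<Rightarrow> 'k \<Rightarrow> 'a) \<Rightarrow> bool"
  assumes step: "\<And>s. (\<And>c. s c \<in> P) \<Longrightarrow> \<exists>a b. (\<forall>c. a c \<in> P) \<and> (\<forall>c. b c \<in> P)
      \<and> (\<forall>c i. (s c i, a c i) \<in> lam i) \<and> \<Phi> a b"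
  obtains a b where "\<And>x c. a x c \<in> P" "\<And>x c. b x c \<in> P" "\<And>x. \<Phi> (a x) (b x)"
    "\<And>c h. \<exists>x\<in>Field theta. {i. (h i, a x c i) \<notin> lam i \<and> (h i, b x c i) \<in> lam i} \<in> I"
proof -
  let ?Q = "\<lambda>x (g :: 't \<Rightarrow> ('c \<Rightarrow> 'k \<Rightarrow> 'a) \<times> ('c \<Rightarrow> 'k \<Rightarrow> 'a)) y.
    (\<forall>c. fst y c \<in> P) \<and> (\<forall>c. snd y c \<in> P) \<and> \<Phi> (fst y) (snd y)
    \<and> (\<forall>z c i. (z, x) \<in> theta - Id \<and> |underS theta x| <o lam i
          \<longrightarrow> (snd (g z) c i, fst y c i) \<in> lam i)"
  have "\<exists>f. \<forall>x. ?Q x f (f x)"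
  proof (rule wf_recursive_choice[OF wf_Card_order[OF card_theta]])
    fix x and g :: "'t \<Rightarrow> ('c \<Rightarrow> 'k \<Rightarrow> 'a) \<times> ('c \<Rightarrow> 'k \<Rightarrow> 'a)"
    assume IH: "\<And>z. (z, x) \<in> theta - Id \<Longrightarrow> ?Q z g (g z)"
    have "\<exists>u\<in>Field (lam i). |underS theta x| <o lam i
        \<longrightarrow> (\<forall>z\<in>underS theta x. (snd (g z) c i, u) \<in> lam i)" for c i
    proof (cases "|underS theta x| <o lam i")
      case True
      let ?K = "(\<lambda>z. snd (g z) c i) ` underS theta x"
      have "?K \<subseteq> Field (lam i)"
        using IH in_Field unfolding underS_def by auto
      then show ?thesis using bounded_at[of ?K i] card_image_less[OF True] by auto
    next
      case False
      then show ?thesis using P_nonempty in_Field by metis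
    qed
    then have bound: "\<exists>u. u \<in> Field (lam i) \<and> ( |underS theta x| <o lam i
        \<longrightarrow> (\<forall>z\<in>underS theta x. (snd (g z) c i, u) \<in> lam i))" for c i by (simp add: Bex_def)
    define s where "s c i = (SOME u. u \<in> Field (lam i) \<and> ( |underS theta x| <o lam i
        \<longrightarrow> (\<forall>z\<in>underS theta x. (snd (g z) c i, u) \<in> lam i)))" for c i
    have s: "s c i \<in> Field (lam i)"
      "|underS theta x| <o lam i \<Longrightarrow> z \<in> underS theta x \<Longrightarrow> (snd (g z) c i, s c i) \<in> lam i" for c i z
      using someI_ex[OF bound[where c = c and i = i]] unfolding s_def by simp_all
    obtain a b where ab: "\<And>c. a c \<in> P" "\<And>c. b c \<in> P" "\<And>c i. (s c i, a c i) \<in> lam i" "\<Phi> a b"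
      using step[of s] s(1) in_P_iff by metis
    have "(snd (g z) c i, a c i) \<in> lam i"
      if "(z, x) \<in> theta - Id" "|underS theta x| <o lam i" for z c i
      by (rule Card_order_transD[OF card_lam s(2)[OF that(2)] ab(3)])
        (use that in \<open>simp add: underS_def\<close>)
    then have "?Q x g (a, b)" using ab by simp
    then show "\<exists>y. ?Q x g y" by (rule exI)
  qed auto
  then obtain f where f: "\<And>x. ?Q x f (f x)" by metis
  define a b where "a = (\<lambda>x. fst (f x))" and "b = (\<lambda>x. snd (f x))"
  have below: "(b z c i, a x c i) \<in> lam i"
    if "(z, x) \<in> theta" "z \<noteq> x" "|underS theta x| <o lam i" for x z c i
    using f[of x] that unfolding a_def b_def by simp
  show thesis
  proof (rule that[of a b])
    show "\<exists>x\<in>Field theta. {i. (h i, a x c i) \<notin> lam i \<and> (h i, b x c i) \<in> lam i} \<in> I"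
      (is "\<exists>x\<in>_. ?E x \<in> I") for c h
    proof (rule ccontr)
      assume no: "\<not> ?thesis"
      \<comment> \<open>Without the coordinates at which stage \<open>x\<close> ignored the earlier ones, the sets are exactly disjoint.\<close>
      let ?E' = "\<lambda>x. ?E x - {i. lam i \<le>o |underS theta x|}"
      have "?E' x \<notin> I" if x: "x \<in> Field theta" for x
      proof
        assume "?E' x \<in> I"
        then have "?E' x \<union> {i. lam i \<le>o |underS theta x|} \<in> I"
          by (rule ideal_Un[OF ideal_I _ small_lam[OF x]])
        then have "?E x \<in> I" by (rule ideal_subset[OF ideal_I]) blast
        then show False using no x by simp
      qed
      then obtain x y where xy: "x \<in> Field theta" "y \<in> Field theta" "x \<noteq> y" "?E' x \<inter> ?E' y \<noteq> {}"
        using saturated[of ?E'] by auto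
      have disj: "?E' z \<inter> ?E' w = {}" if zw: "(z, w) \<in> theta" "z \<noteq> w" for z w
      proof -
        have False if "i \<in> ?E' z" "i \<in> ?E' w" for i
        proof -
          have "|underS theta w| <o lam i"
            using that(2) ordLess_or_ordLeq[OF card_of_Well_order[of "underS theta w"]
                card_order_on_well_order_on[OF card_lam[of i]]] by auto
          then have "(b z c i, a w c i) \<in> lam i" using below[OF zw] by simp
          then have "(h i, a w c i) \<in> lam i"
            using Card_order_transD[OF card_lam, of "h i" "b z c i" i "a w c i"] that(1) by simp
          then show False using that(2) by simp
        qed
        then show ?thesis by auto
      qed
      have "(x, y) \<in> theta \<or> (y, x) \<in> theta"
        using Card_order_total[OF card_theta] xy(1,2) by simp
      then show False using disj[of x y] disj[of y x] xy(3,4) by (metis Int_commute)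
    qed
  qed (use f in \<open>simp_all add: a_def b_def\<close>)
qed

section \<open>Directedness below a cardinal\<close>

text \<open>If a function \<open>s\<close> does not bound the sequence modulo \<open>J\<^sub><\<^sub>\<mu>\<close>, the definition of \<open>J\<^sub><\<^sub>\<mu>\<close> supplies an
  ultrafilter \<open>D\<close> of true cofinality at least \<open>\<mu>\<close> modulo which some \<open>f c\<close> exceeds \<open>s\<close>.  The sequence
  is shorter than \<open>\<mu>\<close>, so it has a bound \<open>u\<close> modulo \<open>D\<close>, and \<open>u\<close> refutes \<open>s\<close>.  After \<open>\<theta>\<close>
  refutations regularity gives one index \<open>d\<close> beyond all the indices \<open>c\<close> that occurred, and \<open>f d\<close>
  contradicts \<open>theta_exhaustion\<close>.\<close>

lemma regular_increasing_bounded: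
  fixes r :: "'c rel" and mu :: "'d rel"
  assumes r: "Card_order r" "regularCard r" "theta <o r" "r <o mu"
    and f: "\<And>c. c \<in> Field r \<Longrightarrow> f c \<in> P"
    and incr: "\<And>c d. (c, d) \<in> r \<Longrightarrow> le_mod (J_less mu I lam) lam (f c) (f d)"
  shows "\<exists>u\<in>P. \<forall>c\<in>Field r. le_mod (J_less mu I lam) lam (f c) u"
proof (rule ccontr)
  let ?J = "J_less mu I lam"
  assume unbounded: "\<not> ?thesis"
  \<comment> \<open>Each stage consists of a single function, so the index type is \<open>unit\<close>.\<close>
  let ?\<Phi> = "\<lambda>a b :: unit \<Rightarrow> 'k \<Rightarrow> 'a. \<exists>D c. admissible D \<and> D \<inter> ?J = {} \<and> c \<in> Field r
    \<and> \<not> le_uf D (f c) (a ()) \<and> (\<forall>d\<in>Field r. le_uf D (f d) (b ()))"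
  have step: "\<exists>a b. (\<forall>c. a c \<in> P) \<and> (\<forall>c. b c \<in> P) \<and> (\<forall>c i. (s c i, a c i) \<in> lam i) \<and> ?\<Phi> a b"
    if s: "\<And>c. s c \<in> P" for s :: "unit \<Rightarrow> 'k \<Rightarrow> 'a"
  proof -
    obtain c where c: "c \<in> Field r" "{i. (f c i, s () i) \<notin> lam i} \<notin> ?J"
      using unbounded s[of "()"] unfolding le_mod_def by auto
    then obtain D where D: "admissible D" "{i. (f c i, s () i) \<notin> lam i} \<in> D" "mu \<le>o tcf_mod D lam"
      unfolding J_less_iff by auto
    have uf: "is_ultrafilter D" using D(1) unfolding admissible_def by simp
    have "|f ` Field r| \<le>o |Field r|" by (rule card_of_image)
    also have "|Field r| =o r" by (rule card_of_Field_ordIso[OF r(1)])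
    finally have "|f ` Field r| <o tcf_mod D lam"
      using r(4) D(3) ordLeq_ordLess_trans ordLess_ordLeq_trans by metis
    then obtain u where u: "u \<in> P" "\<And>d. d \<in> Field r \<Longrightarrow> le_uf D (f d) u"
      using bounded_below_tcf[OF uf, of "f ` Field r"] f by auto
    have "?\<Phi> s (\<lambda>_. u)"
      using D(1) disjoint_J_less[OF D(1,3)] c(1) D(2) not_le_uf[OF uf] u(2)
      by (intro exI[of _ D] exI[of _ c]) simp
    moreover have "(s c i, s c i) \<in> lam i" for c i
      by (rule Card_order_refl[OF card_lam in_Field[OF s]])
    ultimately show ?thesis using s u(1) by (intro exI[of _ s] exI[of _ "\<lambda>_. u"]) simp
  qed
  obtain a b where ab: "\<And>x. ?\<Phi> (a x) (b x)"
    and exh: "\<And>c h. \<exists>x\<in>Field theta. {i. (h i, a x c i) \<notin> lam i \<and> (h i, b x c i) \<in> lam i} \<in> I"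
  proof (rule theta_exhaustion[of ?\<Phi>])
    show "\<exists>a b. (\<forall>c. a c \<in> P) \<and> (\<forall>c. b c \<in> P) \<and> (\<forall>c i. (s c i, a c i) \<in> lam i) \<and> ?\<Phi> a b"
      if "\<And>c. s c \<in> P" for s :: "unit \<Rightarrow> 'k \<Rightarrow> 'a"
      using that by (rule step)
  qed (rule that)
  have "\<forall>x. \<exists>D c. admissible D \<and> D \<inter> ?J = {} \<and> c \<in> Field r
      \<and> \<not> le_uf D (f c) (a x ()) \<and> (\<forall>d\<in>Field r. le_uf D (f d) (b x ()))"
    using ab by (rule allI)
  from choice[OF this] obtain D where "\<forall>x. \<exists>c. admissible (D x) \<and> D x \<inter> ?J = {} \<and> c \<in> Field r
      \<and> \<not> le_uf (D x) (f c) (a x ()) \<and> (\<forall>d\<in>Field r. le_uf (D x) (f d) (b x ()))" ..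
  from choice[OF this] obtain c where Dc: "admissible (D x)" "D x \<inter> ?J = {}" "c x \<in> Field r"
      "\<not> le_uf (D x) (f (c x)) (a x ())" "d \<in> Field r \<Longrightarrow> le_uf (D x) (f d) (b x ())" for x d
    by auto
  have "|c ` Field theta| \<le>o |Field theta|" by (rule card_of_image)
  also have "|Field theta| =o theta" by (rule card_of_Field_ordIso[OF card_theta])
  finally have "|c ` Field theta| <o r" using r(3) ordLeq_ordLess_trans by metis
  then obtain d where d: "d \<in> Field r" "\<And>x. x \<in> Field theta \<Longrightarrow> (c x, d) \<in> r"
    using regularCard_bounded[OF r(1,2), of "c ` Field theta"] Dc(3) by auto
  obtain x where x: "x \<in> Field theta"
    and xI: "{i. (f d i, a x () i) \<notin> lam i \<and> (f d i, b x () i) \<in> lam i} \<in> I" (is "?E \<in> I")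
    using exh[where c = "()" and h = "f d"] by (rule bexE)
  have uf: "is_ultrafilter (D x)" using Dc(1) unfolding admissible_def by simp
  have "le_uf (D x) (f (c x)) (f d)"
    by (rule le_uf_of_le_mod[OF uf Dc(2) incr[OF d(2)[OF x]]])
  then have "\<not> le_uf (D x) (f d) (a x ())"
    using le_uf_trans[OF uf, of "f (c x)" "f d" "a x ()"] Dc(4)[of x] by auto
  then have "{i. (f d i, a x () i) \<notin> lam i} \<inter> {i. (f d i, b x () i) \<in> lam i} \<in> D x"
    unfolding not_le_uf[OF uf] by (rule ultrafilter_Int[OF uf _ Dc(5)[OF d(1)]])
  then have "?E \<in> D x" by (simp add: Collect_conj_eq)
  then show False using xI Dc(1)[of x] unfolding admissible_def by auto
qed

text \<open>Induction on \<open>|F|\<close>.  If \<open>|F| \<le> \<theta>\<close>, directedness modulo \<open>I\<close> suffices.  If \<open>|F|\<close> is regular and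
  larger than \<open>\<theta>\<close>, the induction hypothesis allows \<open>F\<close> to be replaced by an increasing sequence.  If
  \<open>|F|\<close> is singular, bounds of initial segments along a short cofinal set are themselves bounded.
  Since \<open>\<theta>\<close> may be finite, finite \<open>F\<close> form a separate case.\<close>

lemma directed_J_less:
  fixes mu :: "'d rel"
  assumes "F \<subseteq> P" "|F| <o mu"
  shows "\<exists>u\<in>P. \<forall>f\<in>F. le_mod (J_less mu I lam) lam f u"
  using wf_inv_image[OF wf_ordLess, of card_of] assms
proof (induction F rule: wf_induct_rule)
  case (less F)
  let ?J = "J_less mu I lam" and ?r = "|F|"
  note J = J_less_ideal[of mu]
  have r: "Card_order ?r" "Field ?r = F" by (rule card_of_Card_order, rule Field_card_of)
  have IH: "\<exists>u\<in>P. \<forall>f\<in>G. le_mod ?J lam f u" if "G \<subseteq> P" "|G| <o |F|" for G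
    using less.IH[of G] that ordLess_transitive[OF that(2) less.prems(2)] by simp
  have "theta <o |F| \<or> |F| \<le>o theta"
    by (rule ordLess_or_ordLeq[OF card_order_on_well_order_on[OF card_theta] card_of_Well_order])
  then consider (fin) "finite F" | (small) "|F| \<le>o theta"
    | (reg) "theta <o |F|" "regularCard |F|" | (sing) "\<not> regularCard |F|"
    by auto
  then show ?case
  proof cases
    case fin
    then show ?thesis using finite_bounded[OF J _ less.prems(1)] by simp
  next
    case small
    then show ?thesis
      using theta_bounded[OF less.prems(1)] le_mod_mono[OF I_subset_J_less] by metis
  next
    case reg
    obtain p where p: "p \<in> P" by (rule P_nonempty)
    \<comment> \<open>The set \<open>F\<close>, enumerated by itself along the well-order \<open>|F|\<close>; the value \<open>p\<close> makes \<open>s\<close> total.\<close>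
    define s where "s = (\<lambda>f. if f \<in> F then f else p)"
    have sP: "s f \<in> P" for f using p less.prems(1) unfolding s_def by auto
    obtain g where g: "\<And>f. g f \<in> P" "\<And>f i. (s f i, g f i) \<in> lam i"
      "\<And>f h. (f, h) \<in> ?r \<Longrightarrow> le_mod ?J lam (g f) (g h)"
      using increasing_majorant[of ?r ?J s, OF r(1) J IH sP] by metis
    have "\<exists>u\<in>P. \<forall>c\<in>Field ?r. le_mod ?J lam (g c) u"
      by (rule regular_increasing_bounded[OF r(1) reg(2,1) less.prems(2) g(1) g(3)])
    then obtain u where u: "u \<in> P" "\<And>f. f \<in> F \<Longrightarrow> le_mod ?J lam (g f) u"
      unfolding r(2) by auto
    have "le_mod ?J lam f u" if "f \<in> F" for f
    proof -
      have "le_mod ?J lam f (g f)"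
        using le_mod_pointwise[OF J g(2)[of f]] that unfolding s_def by simp
      then show ?thesis by (rule le_mod_trans[OF J _ u(2)[OF that]])
    qed
    then show ?thesis using u(1) by auto
  next
    case sing
    then obtain K where K: "K \<subseteq> F" "cofinal K ?r" "\<not> |K| =o ?r"
      unfolding regularCard_def r(2) by auto
    have "|K| <o ?r"
      using card_of_mono1[OF K(1)] K(3) ordLeq_iff_ordLess_or_ordIso by auto
    have "\<exists>u. u \<in> P \<and> (\<forall>f\<in>underS ?r k. le_mod ?J lam f u)" if "k \<in> K" for k
    proof -
      have "|underS ?r k| <o ?r"
        by (rule card_of_underS[OF r(1)]) (use that K(1) in \<open>simp only: r(2) subset_iff\<close>)
      moreover have "underS ?r k \<subseteq> F"
        using r(2) unfolding underS_def Field_def by auto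
      ultimately show ?thesis using IH[of "underS ?r k"] less.prems(1) by auto
    qed
    then have "\<exists>g. \<forall>k\<in>K. g k \<in> P \<and> (\<forall>f\<in>underS ?r k. le_mod ?J lam f (g k))"
      by (intro bchoice) simp
    then obtain g where g: "\<And>k. k \<in> K \<Longrightarrow> g k \<in> P"
      "\<And>k f. k \<in> K \<Longrightarrow> f \<in> underS ?r k \<Longrightarrow> le_mod ?J lam f (g k)" by auto
    have "g ` K \<subseteq> P" using g(1) by auto
    then obtain u where u: "u \<in> P" "\<And>k. k \<in> K \<Longrightarrow> le_mod ?J lam (g k) u"
      using IH[of "g ` K"] card_image_less[OF \<open>|K| <o ?r\<close>, of g] by auto
    have "le_mod ?J lam f u" if f: "f \<in> F" for f
    proof -
      obtain k where k: "k \<in> K" "f \<in> underS ?r k"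
        using K(2) f r(2) unfolding cofinal_def underS_def by auto
      show ?thesis by (rule le_mod_trans[OF J g(2)[OF k] u(2)[OF k(1)]])
    qed
    then show ?thesis using u(1) by auto
  qed
qed

lemma theta_less_tcf:
  assumes D: "admissible D" shows "theta <o tcf_mod D lam"
proof -
  have uf: "is_ultrafilter D" "D \<inter> I = {}" using D unfolding admissible_def by simp_all
  have "\<exists>u\<in>P. \<forall>f\<in>F. le_uf D f u" if "F \<subseteq> P" "|F| \<le>o theta" for F
    using theta_bounded[OF that] le_uf_of_le_mod[OF uf] by metis
  then show ?thesis by (rule tcf_not_le_bounded[OF uf(1) card_theta])
qed

lemma tcf_ge_of_disjoint_J_less:
  assumes mu: "Card_order mu" and D: "is_ultrafilter D" "D \<inter> J_less mu I lam = {}"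
  shows "mu \<le>o tcf_mod D lam"
proof (rule ccontr)
  let ?t = "tcf_mod D lam"
  note t = Card_order_tcf_mod[OF D(1)]
  assume "\<not> mu \<le>o ?t"
  then have less: "?t <o mu"
    using ordLess_or_ordLeq[OF card_order_on_well_order_on[OF t] card_order_on_well_order_on[OF mu]]
    by simp
  have "\<exists>u\<in>P. \<forall>f\<in>F. le_uf D f u" if "F \<subseteq> P" "|F| \<le>o ?t" for F
    using directed_J_less[OF that(1) ordLeq_ordLess_trans[OF that(2) less]]
      le_uf_of_le_mod[OF D] by metis
  then have "?t <o ?t" by (rule tcf_not_le_bounded[OF D(1) t])
  then show False using ordLess_irreflexive by auto
qed

section \<open>Universal sequences\<close>

text \<open>If no universal sequence exists, every increasing \<open>a\<close> has an ultrafilter \<open>D\<close> of true cofinality \<open>\<mu>\<close>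
  and a function \<open>h\<close> that no term of \<open>a\<close> reaches modulo \<open>D\<close>; a scale modulo \<open>D\<close> serves as the
  refutation \<open>b\<close>.  The \<open>\<theta>\<close> many functions \<open>h\<close> have a common bound \<open>H\<close> modulo \<open>I\<close>.  Each scale reaches
  \<open>H\<close>, and since \<open>\<mu>\<close> is regular and larger than \<open>\<theta>\<close>, all of them do so at one index \<open>d\<close>, whereas the
  sequences \<open>a\<close> stay below \<open>H\<close> there.  This contradicts \<open>theta_exhaustion\<close>.\<close>

lemma universal_sequence:
  fixes mu :: "'c rel"
  assumes mu: "Card_order mu" "regularCard mu" "theta <o mu"
  shows "\<exists>f. (\<forall>c. f c \<in> P) \<and> (\<forall>c d. (c, d) \<in> mu \<longrightarrow> le_mod (J_less mu I lam) lam (f c) (f d))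
    \<and> (\<forall>D h. admissible D \<and> mu =o tcf_mod D lam \<and> h \<in> P \<longrightarrow> (\<exists>c\<in>Field mu. le_uf D h (f c)))"
proof (rule ccontr)
  let ?J = "J_less mu I lam"
  assume none: "\<not> ?thesis"
  let ?\<Phi> = "\<lambda>a b. \<exists>D h. admissible D \<and> h \<in> P \<and> (\<forall>c\<in>Field mu. \<not> le_uf D h (a c))
    \<and> (\<forall>c d. (c, d) \<in> mu \<longrightarrow> le_uf D (b c) (b d)) \<and> (\<forall>h\<in>P. \<exists>c\<in>Field mu. le_uf D h (b c))"
  have step: "\<exists>a b. (\<forall>c. a c \<in> P) \<and> (\<forall>c. b c \<in> P) \<and> (\<forall>c i. (s c i, a c i) \<in> lam i) \<and> ?\<Phi> a b"
    if s: "\<And>c. s c \<in> P" for s :: "'c \<Rightarrow> 'k \<Rightarrow> 'a"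
  proof -
    obtain a where a: "\<And>c. a c \<in> P" "\<And>c i. (s c i, a c i) \<in> lam i"
      "\<And>c d. (c, d) \<in> mu \<Longrightarrow> le_mod ?J lam (a c) (a d)"
      using increasing_majorant[of mu ?J s, OF mu(1) J_less_ideal directed_J_less s] by metis
    then have "\<exists>D h. admissible D \<and> mu =o tcf_mod D lam \<and> h \<in> P
        \<and> (\<forall>c\<in>Field mu. \<not> le_uf D h (a c))"
      using none[unfolded not_ex, THEN spec, of a] by auto
    then obtain D h where D: "admissible D" "mu =o tcf_mod D lam"
      and h: "h \<in> P" "\<forall>c\<in>Field mu. \<not> le_uf D h (a c)" by auto
    have uf: "is_ultrafilter D" using D(1) unfolding admissible_def by simp
    from scale_of_length_tcf[OF uf D(2)] obtain k where "\<forall>c\<in>Field mu. k c \<in> P"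
      "\<forall>c d. (c, d) \<in> mu \<longrightarrow> le_uf D (k c) (k d)"
      "\<forall>h\<in>P. \<exists>c\<in>Field mu. le_uf D h (k c)"
      by (elim exE conjE)
    note k = this[rule_format]
    \<comment> \<open>The scale is controlled only on \<open>Field mu\<close>; elsewhere any member of the product will do.\<close>
    define b where "b = (\<lambda>c. if c \<in> Field mu then k c else s c)"
    have bP: "b c \<in> P" for c using k(1) s unfolding b_def by simp
    have bk: "b c = k c" if "c \<in> Field mu" for c using that unfolding b_def by simp
    have b_mono: "le_uf D (b c) (b d)" if "(c, d) \<in> mu" for c d
      using k(2)[OF that] bk[OF FieldI1[OF that]] bk[OF FieldI2[OF that]] by simp
    have b_cofinal: "\<exists>c\<in>Field mu. le_uf D h (b c)" if "h \<in> P" for h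
      using k(3)[OF that] bk by auto
    have "?\<Phi> a b"
      using D(1) h b_mono b_cofinal by (intro exI[of _ D] exI[of _ h]) simp
    then show ?thesis using a(1,2) bP by (intro exI[of _ a] exI[of _ b]) simp
  qed
  obtain a b where ab: "\<And>x. ?\<Phi> (a x) (b x)"
    and exh: "\<And>c h. \<exists>x\<in>Field theta. {i. (h i, a x c i) \<notin> lam i \<and> (h i, b x c i) \<in> lam i} \<in> I"
  proof (rule theta_exhaustion[of ?\<Phi>])
    show "\<exists>a b. (\<forall>c. a c \<in> P) \<and> (\<forall>c. b c \<in> P) \<and> (\<forall>c i. (s c i, a c i) \<in> lam i) \<and> ?\<Phi> a b"
      if "\<And>c. s c \<in> P" for s :: "'c \<Rightarrow> 'k \<Rightarrow> 'a"
      using that by (rule step)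
  qed (rule that)
  have "\<forall>x. ?\<Phi> (a x) (b x)" using ab by (rule allI)
  from choice[OF this] obtain D where "\<forall>x. \<exists>h. admissible (D x) \<and> h \<in> P
      \<and> (\<forall>c\<in>Field mu. \<not> le_uf (D x) h (a x c))
      \<and> (\<forall>c d. (c, d) \<in> mu \<longrightarrow> le_uf (D x) (b x c) (b x d))
      \<and> (\<forall>h\<in>P. \<exists>c\<in>Field mu. le_uf (D x) h (b x c))" ..
  from choice[OF this] obtain h where "\<forall>x. admissible (D x) \<and> h x \<in> P
      \<and> (\<forall>c\<in>Field mu. \<not> le_uf (D x) (h x) (a x c))
      \<and> (\<forall>c d. (c, d) \<in> mu \<longrightarrow> le_uf (D x) (b x c) (b x d))
      \<and> (\<forall>h\<in>P. \<exists>c\<in>Field mu. le_uf (D x) h (b x c))" ..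
  then have D: "\<And>x. admissible (D x)" and h: "\<And>x. h x \<in> P"
    and unreached: "\<And>x c. c \<in> Field mu \<Longrightarrow> \<not> le_uf (D x) (h x) (a x c)"
    and mono: "\<And>x c d. (c, d) \<in> mu \<Longrightarrow> le_uf (D x) (b x c) (b x d)"
    and cofinal: "\<And>x g. g \<in> P \<Longrightarrow> \<exists>c\<in>Field mu. le_uf (D x) g (b x c)"
    by simp_all
  have uf: "is_ultrafilter (D x)" "D x \<inter> I = {}" for x
    using D unfolding admissible_def by simp_all
  have im: "|g ` Field theta| \<le>o theta" for g :: "'t \<Rightarrow> 'z"
    by (rule ordLeq_ordIso_trans[OF card_of_image card_of_Field_ordIso[OF card_theta]])
  have "h ` Field theta \<subseteq> P" using h by auto
  then obtain H where H: "H \<in> P" "\<And>x. x \<in> Field theta \<Longrightarrow> le_mod I lam (h x) H"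
    using theta_bounded[OF _ im, of h] by auto
  have "\<forall>x. \<exists>c. c \<in> Field mu \<and> le_uf (D x) H (b x c)" using cofinal[OF H(1)] by auto
  from choice[OF this] obtain c where c: "\<And>x. c x \<in> Field mu" "\<And>x. le_uf (D x) H (b x (c x))"
    by auto
  have "|c ` Field theta| <o mu" by (rule ordLeq_ordLess_trans[OF im mu(3)])
  then obtain d where d: "d \<in> Field mu" "\<And>x. x \<in> Field theta \<Longrightarrow> (c x, d) \<in> mu"
    using regularCard_bounded[OF mu(1,2), of "c ` Field theta"] c(1) by auto
  obtain x where x: "x \<in> Field theta"
    and xI: "{i. (H i, a x d i) \<notin> lam i \<and> (H i, b x d i) \<in> lam i} \<in> I" (is "?E \<in> I")
    using exh[where c = d and h = H] by (rule bexE)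
  have "le_uf (D x) H (b x d)"
    by (rule le_uf_trans[OF uf(1) c(2) mono[OF d(2)[OF x]]])
  moreover have "\<not> le_uf (D x) H (a x d)"
  proof
    assume "le_uf (D x) H (a x d)"
    then have "le_uf (D x) (h x) (a x d)"
      by (rule le_uf_trans[OF uf(1) le_uf_of_le_mod[OF uf H(2)[OF x]]])
    then show False using unreached[OF d(1)] by simp
  qed
  ultimately have "{i. (H i, a x d i) \<notin> lam i} \<inter> {i. (H i, b x d i) \<in> lam i} \<in> D x"
    unfolding not_le_uf[OF uf(1)] by (intro ultrafilter_Int[OF uf(1)])
  then have "?E \<in> D x" by (simp add: Collect_conj_eq)
  then show False using xI uf(2)[of x] by auto
qed

section \<open>Semi-normality\<close>

lemma semi_normal_of_regular_pcf:
  fixes mu :: "'c rel"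
  assumes mu: "Card_order mu" "regularCard mu" and pcf: "mu \<in> pcf I lam"
  shows "semi_normal mu I lam"
proof -
  let ?J = "J_less mu I lam" and ?K = "J_le mu I lam"
  have K: "is_ideal ?K" unfolding J_le_def by (rule J_less_ideal)
  obtain D0 where D0: "admissible D0" "mu =o tcf_mod D0 lam"
    using pcf unfolding pcf_def admissible_def by auto
  have "theta <o mu"
    by (rule ordLess_ordIso_trans[OF theta_less_tcf[OF D0(1)] ordIso_symmetric[OF D0(2)]])
  from universal_sequence[OF mu this] obtain f where "\<forall>c. f c \<in> P"
    "\<forall>c d. (c, d) \<in> mu \<longrightarrow> le_mod ?J lam (f c) (f d)"
    "\<forall>D h. admissible D \<and> mu =o tcf_mod D lam \<and> h \<in> P \<longrightarrow> (\<exists>c\<in>Field mu. le_uf D h (f c))"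
    by (elim exE conjE)
  note f = this(1)[rule_format] and incr = this(2)[rule_format] and univ = this(3)[rule_format]
  have "|f ` Field mu| \<le>o mu"
    by (rule ordLeq_ordIso_trans[OF card_of_image card_of_Field_ordIso[OF mu(1)]])
  then have "|f ` Field mu| <o cardSuc mu"
    by (rule ordLeq_ordLess_trans[OF _ cardSuc_greater[OF mu(1)]])
  then obtain u where u: "u \<in> P" "\<And>c. c \<in> Field mu \<Longrightarrow> le_mod ?K lam (f c) u"
    using directed_J_less[of "f ` Field mu" "cardSuc mu"] f unfolding J_le_def by auto
  \<comment> \<open>An \<open>f c\<close> that reaches \<open>v\<close> modulo an ultrafilter exceeds \<open>u\<close> on a set in that ultrafilter.\<close>
  obtain v where v: "v \<in> P" "\<And>i. (v i, u i) \<notin> lam i"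
    using P_strictly_above[OF u(1)] by metis
  define B where "B c = {i. (f c i, u i) \<notin> lam i}" for c
  have B_incr: "B c - B d \<in> ?J" if "(c, d) \<in> mu" for c d
  proof -
    have "{i. (f c i, f d i) \<notin> lam i} \<in> ?J" using incr[OF that] unfolding le_mod_def .
    moreover have "B c - B d \<subseteq> {i. (f c i, f d i) \<notin> lam i}"
      using Card_order_transD[OF card_lam] unfolding B_def by blast
    ultimately show ?thesis by (rule ideal_subset[OF J_less_ideal])
  qed
  let ?H = "is_ideal hull (?J \<union> B ` Field mu)"
  have "?H \<subseteq> ?K"
  proof (rule hull_minimal[of _ _ is_ideal, OF _ K], rule Un_least)
    show "?J \<subseteq> ?K"
      unfolding J_le_def J_less_def using ordLeq_transitive[OF cardSuc_ordLeq[OF mu(1)]] by blast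
    show "B ` Field mu \<subseteq> ?K" using u(2) unfolding le_mod_def B_def by auto
  qed
  moreover have "X \<in> ?H" if X: "X \<in> ?K" for X
  proof (rule ccontr)
    assume "X \<notin> ?H"
    then obtain D where D: "is_ultrafilter D" "X \<in> D" "D \<inter> ?H = {}"
      by (rule ultrafilter_avoiding_ideal[OF is_ideal_hull])
    have sub: "?J \<union> B ` Field mu \<subseteq> ?H" by (rule hull_subset)
    have DJ: "D \<inter> ?J = {}" using D(3) sub by auto
    then have adm: "admissible D"
      using D(1) I_subset_J_less[of mu] unfolding admissible_def by auto
    have "mu \<le>o tcf_mod D lam" by (rule tcf_ge_of_disjoint_J_less[OF mu(1) D(1) DJ])
    moreover have "\<not> cardSuc mu \<le>o tcf_mod D lam"
      using X adm D(2) unfolding J_le_def J_less_iff by auto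
    then have "\<not> mu <o tcf_mod D lam"
      using cardSuc_least[OF mu(1) Card_order_tcf_mod[OF D(1)]] by auto
    ultimately have "mu =o tcf_mod D lam" using ordLeq_iff_ordLess_or_ordIso by auto
    from univ[OF conjI[OF adm conjI[OF this v(1)]]] obtain c
      where c: "c \<in> Field mu" "le_uf D v (f c)" by (rule bexE)
    have "{i. (v i, f c i) \<in> lam i} \<subseteq> B c"
      using v(2) Card_order_transD[OF card_lam] unfolding B_def by blast
    then have "B c \<in> D" by (rule ultrafilter_superset[OF D(1) c(2)])
    then show False using D(3) sub c(1) by auto
  qed
  ultimately have "?K = ?H" by auto
  then show ?thesis
    unfolding semi_normal_def using pcf B_incr by auto
qed

end

section \<open>The two hypotheses\<close>

text \<open>Any disjoint family of positive sets becomes a partition of \<open>\<kappa>\<close> into as many positive sets when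
  one member is enlarged by all uncovered points.  Since \<open>wsat I \<le> \<theta>\<close>, a family of size \<open>\<theta>\<close> has a
  subfamily of size \<open>wsat I\<close>.\<close>

lemma wsat_saturated:
  fixes I :: "'k set set" and theta :: "'t rel"
  assumes I: "proper_ideal I" and wsat: "wsat I \<le>o theta"
    and E: "\<And>x. x \<in> Field theta \<Longrightarrow> E x \<notin> I"
  shows "\<exists>x\<in>Field theta. \<exists>y\<in>Field theta. x \<noteq> y \<and> E x \<inter> E y \<noteq> {}"
proof (rule ccontr)
  assume "\<not> ?thesis"
  then have disj: "E x \<inter> E y = {}" if "x \<in> Field theta" "y \<in> Field theta" "x \<noteq> y" for x y
    using that by blast
  have ideal: "is_ideal I" using I unfolding proper_ideal_def by simp
  let ?split = "\<lambda>r :: 'k set rel. \<exists>Q. partition_on UNIV Q \<and> Q \<subseteq> positive I \<and> |Q| =o r"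
  let ?W = "\<lambda>r :: 'k set rel. Field r \<noteq> {} \<and> \<not> ?split r"
  let ?u = "|UNIV :: 'k set set|"
  \<comment> \<open>The least cardinal exists on this type: a partition of \<open>\<kappa>\<close> has at most \<open>\<kappa> < 2\<^sup>\<kappa>\<close> pieces.\<close>
  have "\<not> ?split ?u"
  proof
    assume "?split ?u"
    then obtain Q :: "'k set set" where Q: "partition_on UNIV Q" "|Q| =o ?u" by auto
    have pick: "(SOME x. x \<in> q) \<in> q" if "q \<in> Q" for q
      using that partition_onD3[OF Q(1)] by (metis some_in_eq)
    have "inj_on (\<lambda>q. SOME x. x \<in> q) Q"
    proof (rule inj_onI)
      fix p q assume pq: "p \<in> Q" "q \<in> Q" "(SOME x. x \<in> p) = (SOME x. x \<in> q)"
      then have "(SOME x. x \<in> p) \<in> p \<inter> q" using pick[of p] pick[of q] by simp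
      then show "p = q" using partition_onD2[OF Q(1)] pq(1,2) unfolding disjoint_def by auto
    qed
    then have "|Q| \<le>o |UNIV :: 'k set|" by (rule card_of_ordLeqI) simp
    also have "|UNIV :: 'k set| <o ?u" using card_of_Pow[of "UNIV :: 'k set"] by simp
    finally show False using Q(2) not_ordLess_ordIso by auto
  qed
  moreover have "Field ?u \<noteq> {}" unfolding Field_card_of by simp
  ultimately have "?W ?u" by simp
  then have "?W (wsat I)"
    using least_card[of ?u ?W] card_of_Card_order unfolding wsat_def by auto
  then obtain x0 where x0: "x0 \<in> Field (wsat I)" and W: "\<not> ?split (wsat I)" by auto
  have card: "Card_order (wsat I)"
    using least_card[of ?u ?W] card_of_Card_order \<open>?W ?u\<close> unfolding wsat_def by auto
  obtain e where e: "inj_on e (Field (wsat I))" "e ` Field (wsat I) \<subseteq> Field theta"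
    using card_of_mono2[OF wsat] unfolding card_of_ordLeq[symmetric] by auto
  let ?F = "Field (wsat I)"
  \<comment> \<open>The piece at \<open>x0\<close> is the complement \<open>- R\<close> of all the others.\<close>
  define R where "R = (\<Union>x\<in>?F - {x0}. E (e x))"
  define G where "G x = (if x = x0 then - R else E (e x))" for x
  have disj_e: "E (e x) \<inter> E (e y) = {}" if "x \<in> ?F" "y \<in> ?F" "x \<noteq> y" for x y
    using that e by (intro disj) (auto simp: inj_on_def)
  have G_pos: "G x \<notin> I" if x: "x \<in> ?F" for x
  proof -
    have "E (e x) \<subseteq> G x" using disj_e[OF x] unfolding G_def R_def by auto
    then show ?thesis using E[of "e x"] ideal_subset[OF ideal] e(2) x by auto
  qed
  have G_disj: "G x \<inter> G y = {}" if "x \<in> ?F" "y \<in> ?F" "x \<noteq> y" for x y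
    using that disj_e[OF that] unfolding G_def R_def by auto
  have G_ne: "G x \<noteq> {}" if "x \<in> ?F" for x
    using G_pos[OF that] ideal_empty[OF ideal] by auto
  have "inj_on G ?F"
  proof (rule inj_onI)
    fix x y assume "x \<in> ?F" "y \<in> ?F" "G x = G y"
    then show "x = y" using G_disj[of x y] G_ne[of x] by auto
  qed
  then have "|?F| =o |G ` ?F|" by (intro card_of_ordIsoI) (simp add: bij_betw_def)
  then have "|G ` ?F| =o wsat I"
    by (rule ordIso_transitive[OF ordIso_symmetric card_of_Field_ordIso[OF card]])
  moreover have "partition_on UNIV (G ` ?F)"
  proof (rule partition_onI)
    show "\<Union> (G ` ?F) = UNIV"
    proof (intro set_eqI iffI UNIV_I)
      fix i
      show "i \<in> \<Union> (G ` ?F)"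
      proof (cases "i \<in> R")
        case True
        then obtain x where "x \<in> ?F" "x \<noteq> x0" "i \<in> E (e x)" unfolding R_def by auto
        then show ?thesis unfolding G_def by auto
      next
        case False
        then have "i \<in> G x0" unfolding G_def by simp
        then show ?thesis using x0 by auto
      qed
    qed
    show "disjnt p q" if "p \<in> G ` ?F" "q \<in> G ` ?F" "p \<noteq> q" for p q
      using that G_disj unfolding disjnt_def by auto
    show "{} \<notin> G ` ?F" using G_ne by auto
  qed
  moreover have "G ` ?F \<subseteq> positive I" using G_pos unfolding positive_def by auto
  ultimately show False using W by auto
qed

text \<open>A proper initial segment of \<open>\<theta>\<close> is smaller than the limit inferior, so its size does not belong to
  the cardinals over which the minimum is taken.  The minimum ranges over cardinals on the type of
  the \<open>\<lambda>\<^sub>i\<close>, hence the passage to a set \<open>B\<close> of that type.\<close>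

lemma small_of_le_liminf:
  fixes lam :: "'k \<Rightarrow> 'a rel"
  assumes theta: "Card_order theta" "theta \<le>o liminf_card I lam" and x: "x \<in> Field theta"
  shows "{i. lam i \<le>o |underS theta x|} \<in> I"
proof (rule ccontr)
  let ?L = "liminf_card I lam"
  assume pos: "\<not> ?thesis"
  have less: "|underS theta x| <o ?L"
    by (rule ordLess_ordLeq_trans[OF card_of_underS[OF theta(1) x] theta(2)])
  from iffD1[OF internalize_card_of_ordLeq ordLess_imp_ordLeq[OF less]]
  obtain B :: "'a set" where B: "|underS theta x| =o |B|" by (elim exE conjE)
  have "lam i \<le>o |B| \<longleftrightarrow> lam i \<le>o |underS theta x|" for i
    using ordLeq_ordIso_trans[OF _ B] ordLeq_ordIso_trans[OF _ ordIso_symmetric[OF B]] by auto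
  then have "{i. lam i \<le>o |B|} \<in> positive I" using pos unfolding positive_def by simp
  then have "?L \<le>o |B|"
    using least_card[of "|B|" "\<lambda>mu. {i. lam i \<le>o mu} \<in> positive I"] card_of_Card_order
    unfolding liminf_card_def by auto
  then have "?L \<le>o |underS theta x|" by (rule ordLeq_ordIso_trans[OF _ ordIso_symmetric[OF B]])
  then show False using less not_ordLess_ordLeq by auto
qed

theorem lemma2p8:
  fixes lam :: "'k \<Rightarrow> 'a rel"
    and I :: "'k set set"
    and theta :: "'t rel"
    and mu :: "'c rel"
  assumes "infinite (UNIV :: 'k set)"
    and "proper_ideal I"
    and "\<And>i. Cinfinite (lam i) \<and> regularCard (lam i)"
    and "Card_order theta"
    and "(\<forall>i. theta <o lam i) \<and> wsat I \<le>o theta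
       \<or> theta \<le>o liminf_card I lam \<and> wsat I \<le>o theta
         \<and> directed (cardSuc theta) (card_prod lam) (le_mod I lam)"
    and "Card_order mu" and "regularCard mu"
    and "mu \<in> pcf I lam"
  shows "semi_normal mu I lam"
proof -
  interpret regular_product lam I
    by unfold_locales (rule assms(2), rule assms(3))
  have "pcf_setting lam I theta"
  proof unfold_locales
    show "Card_order theta" by (rule assms(4))
    show "\<exists>x\<in>Field theta. \<exists>y\<in>Field theta. x \<noteq> y \<and> E x \<inter> E y \<noteq> {}"
      if "\<And>x. x \<in> Field theta \<Longrightarrow> E x \<notin> I" for E
      using assms(5) by (intro wsat_saturated[OF assms(2) _ that]) auto
    show "{i. lam i \<le>o |underS theta x|} \<in> I" if x: "x \<in> Field theta" for x
      using assms(5)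
    proof (elim disjE conjE)
      assume above: "\<forall>i. theta <o lam i"
      have "\<not> lam i \<le>o |underS theta x|" for i
        using ordLess_transitive[OF card_of_underS[OF assms(4) x] spec[OF above]]
          not_ordLess_ordLeq by auto
      then show ?thesis using ideal_empty[OF ideal_I] by simp
    next
      assume "theta \<le>o liminf_card I lam"
      then show ?thesis by (rule small_of_le_liminf[OF assms(4) _ x])
    qed
    show "\<exists>u\<in>P. \<forall>f\<in>F. le_mod I lam f u" if F: "F \<subseteq> P" "|F| \<le>o theta" for F
      using assms(5)
    proof (elim disjE conjE)
      assume above: "\<forall>i. theta <o lam i"
      have "\<exists>u\<in>Field (lam i). \<forall>x\<in>(\<lambda>f. f i) ` F. (x, u) \<in> lam i" for i
      proof (rule bounded_at)
        show "(\<lambda>f. f i) ` F \<subseteq> Field (lam i)" using F(1) in_Field by auto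
        show "|(\<lambda>f. f i) ` F| <o lam i"
          by (rule card_image_less[OF ordLeq_ordLess_trans[OF F(2) spec[OF above]]])
      qed
      then have "\<forall>i. \<exists>u. u \<in> Field (lam i) \<and> (\<forall>f\<in>F. (f i, u) \<in> lam i)" by auto
      from choice[OF this] obtain u where
        u: "\<And>i. u i \<in> Field (lam i)" "\<And>i f. f \<in> F \<Longrightarrow> (f i, u i) \<in> lam i" by auto
      have "u \<in> P" using u(1) in_P_iff by simp
      moreover have "le_mod I lam f u" if "f \<in> F" for f
        by (rule le_mod_pointwise[OF ideal_I u(2)[OF that]])
      ultimately show ?thesis by auto
    next
      assume dir: "directed (cardSuc theta) P (le_mod I lam)"
      have "|F| <o cardSuc theta"
        using F(2) cardSuc_ordLeq_ordLess[OF assms(4) card_of_Card_order] by auto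
      then show ?thesis using dir F(1) unfolding directed_def by simp
    qed
  qed
  then show ?thesis
    by (rule pcf_setting.semi_normal_of_regular_pcf[OF _ assms(6-8)])
qed

end
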